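(* For any integer $k\ge 2$, every $\frac{1}{k-1}$-tough $2K_2$-free graph $G$ admits a $k$-walk. Moreover, such a $k$-walk can be found in time polynomial in $|V(G)|$.
   Context: Graphs are finite, simple, undirected and have at least one vertex. For a real $\beta>0$, a graph $G$ is $\beta$-tough if for any integer $p\ge 2$ it cannot be split into $p$ connected components by removing fewer than $p\beta$ vertices (removing no vertices is allowed, so a $\beta$-tough graph is connected). A graph is $2K_2$-free if it does not contain an induced subgraph isomorphic to the disjoint union of two edges. For a positive integer $p$, $p\times G$ denotes the multigraph obtained from $G$ by taking each edge $p$ times. A $k$-walk in $G$ is a connected spanning subgraph $W$ of the multigraph $2k\times G$ such that each vertex of $W$ has even degree at most $2k$ in $W$. *)

theory Defs
  imports "HOL-Library.Multiset" "HOL-Computational_Algebra.Polynomial"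
begin

record 'a graph =
  verts :: "'a set"
  edges :: "'a set set"

definition simple_graph :: "'a graph \<Rightarrow> bool" where
  "simple_graph G \<longleftrightarrow> finite (verts G) \<and> verts G \<noteq> {} \<and>
     (\<forall>e \<in> edges G. e \<subseteq> verts G \<and> card e = 2)"

definition induced :: "'a graph \<Rightarrow> 'a set \<Rightarrow> 'a graph" where
  "induced G S = \<lparr>verts = verts G \<inter> S, edges = {e \<in> edges G. e \<subseteq> S}\<rparr>"

definition delete_verts :: "'a graph \<Rightarrow> 'a set \<Rightarrow> 'a graph" where
  "delete_verts G S = induced G (verts G - S)"

definition reach :: "'a graph \<Rightarrow> ('a \<times> 'a) set" where
  "reach G = {(u, v) \<in> verts G \<times> verts G. (u, v) \<in> {(x, y). {x, y} \<in> edges G}\<^sup>*}"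

definition connected_graph :: "'a graph \<Rightarrow> bool" where
  "connected_graph G \<longleftrightarrow> verts G \<noteq> {} \<and> (\<forall>u \<in> verts G. \<forall>v \<in> verts G. (u, v) \<in> reach G)"

definition components :: "'a graph \<Rightarrow> 'a set set" where
  "components G = verts G // reach G"

definition tough :: "real \<Rightarrow> 'a graph \<Rightarrow> bool" where
  "tough \<beta> G \<longleftrightarrow> (\<forall>p::nat. p \<ge> 2 \<longrightarrow>
     \<not> (\<exists>S \<subseteq> verts G. real (card S) < real p * \<beta> \<and> card (components (delete_verts G S)) = p))"

definition graph_iso :: "'a graph \<Rightarrow> 'b graph \<Rightarrow> bool" where
  "graph_iso G H \<longleftrightarrow> (\<exists>f. bij_betw f (verts G) (verts H) \<and>
     (\<forall>u \<in> verts G. \<forall>v \<in> verts G. {u, v} \<in> edges G \<longleftrightarrow> {f u, f v} \<in> edges H))"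

definition two_K2 :: "nat graph" where
  "two_K2 = \<lparr>verts = {0, 1, 2, 3}, edges = {{0, 1}, {2, 3}}\<rparr>"

definition two_K2_free :: "'a graph \<Rightarrow> bool" where
  "two_K2_free G \<longleftrightarrow> \<not> (\<exists>S \<subseteq> verts G. graph_iso two_K2 (induced G S))"

record 'a multigraph =
  mverts :: "'a set"
  medges :: "'a set multiset"

definition times_graph :: "nat \<Rightarrow> 'a graph \<Rightarrow> 'a multigraph" where
  "times_graph p G = \<lparr>mverts = verts G, medges = repeat_mset p (mset_set (edges G))\<rparr>"

definition spanning_subgraph :: "'a multigraph \<Rightarrow> 'a multigraph \<Rightarrow> bool" where
  "spanning_subgraph W H \<longleftrightarrow> mverts W = mverts H \<and> medges W \<subseteq># medges H"

definition mconnected :: "'a multigraph \<Rightarrow> bool" where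
  "mconnected W \<longleftrightarrow> connected_graph \<lparr>verts = mverts W, edges = set_mset (medges W)\<rparr>"

definition mdegree :: "'a multigraph \<Rightarrow> 'a \<Rightarrow> nat" where
  "mdegree W v = size {# e \<in># medges W. v \<in> e #}"

definition k_walk :: "nat \<Rightarrow> 'a graph \<Rightarrow> 'a multigraph \<Rightarrow> bool" where
  "k_walk k G W \<longleftrightarrow> spanning_subgraph W (times_graph (2 * k) G) \<and> mconnected W \<and>
     (\<forall>v \<in> mverts W. even (mdegree W v) \<and> mdegree W v \<le> 2 * k)"

text \<open>
  Algorithms are programs of a structured random access machine: a while-language over natural
  numbers with scalar variables and two-dimensional arrays with computed indices. Assignments
  and tests take unit time. Since a program contains only finitely many expressions, each of
  constant size, this differs from charging every operation by a constant factor only. The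
  arithmetic is restricted to addition and truncated subtraction, so that the bit length of the
  stored values grows by at most a constant per step; hence polynomial time on this machine
  agrees with polynomial time on Turing machines. (Unit-cost multiplication would destroy this.)
\<close>

type_synonym vname = string

record state =
  scalar :: "vname \<Rightarrow> nat"
  arr :: "vname \<Rightarrow> nat \<Rightarrow> nat \<Rightarrow> nat"

datatype aexp =
    Const nat
  | Var vname
  | Read vname aexp aexp
  | Add aexp aexp
  | Sub aexp aexp

datatype bexp =
    Less aexp aexp
  | Equal aexp aexp
  | Neg bexp
  | Conj bexp bexp

datatype com =
    Skip
  | Assign vname aexp
  | Write vname aexp aexp aexp
  | Seq com com
  | Cond bexp com com
  | Loop bexp com

fun aval :: "aexp \<Rightarrow> state \<Rightarrow> nat" where
  "aval (Const m) s = m"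
| "aval (Var x) s = scalar s x"
| "aval (Read x a b) s = arr s x (aval a s) (aval b s)"
| "aval (Add a b) s = aval a s + aval b s"
| "aval (Sub a b) s = aval a s - aval b s"

fun bval :: "bexp \<Rightarrow> state \<Rightarrow> bool" where
  "bval (Less a b) s = (aval a s < aval b s)"
| "bval (Equal a b) s = (aval a s = aval b s)"
| "bval (Neg b) s = (\<not> bval b s)"
| "bval (Conj b c) s = (bval b s \<and> bval c s)"

definition set_scalar :: "vname \<Rightarrow> nat \<Rightarrow> state \<Rightarrow> state" where
  "set_scalar x m s = s\<lparr>scalar := (scalar s)(x := m)\<rparr>"

definition set_arr :: "vname \<Rightarrow> nat \<Rightarrow> nat \<Rightarrow> nat \<Rightarrow> state \<Rightarrow> state" where
  "set_arr x i j m s = s\<lparr>arr := (arr s)(x := (arr s x)(i := (arr s x i)(j := m)))\<rparr>"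

text \<open>\<open>runs c s t s'\<close>: started in state \<open>s\<close>, program \<open>c\<close> halts after \<open>t\<close> steps in state \<open>s'\<close>.\<close>

inductive runs :: "com \<Rightarrow> state \<Rightarrow> nat \<Rightarrow> state \<Rightarrow> bool" where
  Skip: "runs Skip s 1 s"
| Assign: "runs (Assign x a) s 1 (set_scalar x (aval a s) s)"
| Write: "runs (Write x a b c) s 1 (set_arr x (aval a s) (aval b s) (aval c s) s)"
| Seq: "runs c s t s' \<Longrightarrow> runs d s' t' s'' \<Longrightarrow> runs (Seq c d) s (t + t') s''"
| CondTrue: "bval b s \<Longrightarrow> runs c s t s' \<Longrightarrow> runs (Cond b c d) s (1 + t) s'"
| CondFalse: "\<not> bval b s \<Longrightarrow> runs d s t s' \<Longrightarrow> runs (Cond b c d) s (1 + t) s'"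
| LoopFalse: "\<not> bval b s \<Longrightarrow> runs (Loop b c) s 1 s"
| LoopTrue: "bval b s \<Longrightarrow> runs c s t s' \<Longrightarrow> runs (Loop b c) s' t' s'' \<Longrightarrow>
    runs (Loop b c) s (1 + t + t') s''"

inductive_cases Skip_runsE: "runs Skip s t s'"
inductive_cases Assign_runsE: "runs (Assign x a) s t s'"
inductive_cases Write_runsE: "runs (Write x a b c) s t s'"
inductive_cases Seq_runsE: "runs (Seq c d) s t s'"
inductive_cases Cond_runsE: "runs (Cond b c d) s t s'"
inductive_cases Loop_runsE: "runs (Loop b c) s t s'"

lemma runs_deterministic:
  "runs c s t s' \<Longrightarrow> runs c s u s'' \<Longrightarrow> u = t \<and> s'' = s'"
proof (induction arbitrary: u s'' rule: runs.induct)
  case (Skip s)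
  then show ?case by (auto elim: Skip_runsE)
next
  case (Assign x a s)
  then show ?case by (auto elim: Assign_runsE)
next
  case (Write x a b c s)
  then show ?case by (auto elim: Write_runsE)
next
  case (Seq c s t s' d t' s2)
  from Seq.prems show ?case by (rule Seq_runsE) (auto dest!: Seq.IH)
next
  case (CondTrue b s c t s' d)
  from CondTrue.prems show ?case
    by (rule Cond_runsE) (auto simp: CondTrue.hyps(1) dest!: CondTrue.IH)
next
  case (CondFalse b s d t s' c)
  from CondFalse.prems show ?case
    by (rule Cond_runsE) (auto simp: CondFalse.hyps(1) dest!: CondFalse.IH)
next
  case (LoopFalse b s c)
  from LoopFalse.prems LoopFalse.hyps show ?case
    by (auto elim: Loop_runsE)
next
  case (LoopTrue b s c t s' t' s2)
  from LoopTrue.prems show ?case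
    by (rule Loop_runsE) (auto simp: LoopTrue.hyps(1) dest!: LoopTrue.IH)
qed

text \<open>
  The input is a graph on the vertices \<open>0, \<dots>, n - 1\<close>, given by \<open>n\<close> and its adjacency matrix,
  together with \<open>k\<close>; all other memory is zero.
\<close>

definition input_state :: "nat \<Rightarrow> nat graph \<Rightarrow> state" where
  "input_state k G = \<lparr>
     scalar = (\<lambda>_. 0)(''n'' := card (verts G), ''k'' := k),
     arr = (\<lambda>_ _ _. 0)(''E'' := (\<lambda>u v. if {u, v} \<in> edges G then 1 else 0))\<rparr>"

text \<open>
  The output is read from the array \<open>W\<close>: for \<open>u < v < n\<close>, its \<open>(u, v)\<close> entry is the multiplicity
  of the edge \<open>{u, v}\<close>. Entries on or below the diagonal are ignored.
\<close>

definition output_multigraph :: "nat \<Rightarrow> state \<Rightarrow> nat multigraph" where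
  "output_multigraph n s = \<lparr>
     mverts = {..<n},
     medges = (\<Sum>v<n. \<Sum>u<v. replicate_mset (arr s ''W'' u v) {u, v})\<rparr>"

end

theory Submission
  imports Defs
begin

text \<open>
  Two facts carry the proof. The first concerns cycles, where a single edge traversed back and
  forth counts as a cycle. Suppose that two vertices \<open>x\<close>, \<open>y\<close> outside a cycle are adjacent. As there
  is no induced \<open>2K\<^sub>2\<close>, every edge of the cycle has an end that is adjacent to \<open>x\<close> or \<open>y\<close>. Where two
  consecutive cycle vertices have this property, \<open>x\<close>, \<open>y\<close> or both can be inserted between them.
  Otherwise the property alternates along the cycle; take a cycle vertex \<open>w\<close> without it. If \<open>w\<close> has a
  neighbour \<open>z\<close> outside the cycle, then \<open>z\<close> is adjacent to \<open>x\<close> or \<open>y\<close>, and a path that starts with \<open>z\<close>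
  fits between \<open>w\<close> and its successor. If it has none, \<open>w\<close> can be exchanged for \<open>x\<close>, for \<open>y\<close>, or
  for the edge between them. Each of these operations removes an edge from the graph outside the
  cycle and adds none (\<open>splice_exists\<close>, \<open>outer_edges_splice\<close>), so they lead to a cycle whose
  complement \<open>I\<close> is independent.

  The second fact concerns the assignment of the vertices in \<open>I\<close> to neighbours on the cycle.
  Deleting the neighbourhood of a set \<open>A \<subseteq> I\<close> isolates every vertex of \<open>A\<close>, so toughness yields
  \<open>|A| \<le> (k - 1) |N(A)|\<close> (\<open>tough_neighbours\<close>). This is Hall's condition for giving each vertex of \<open>I\<close>
  a neighbour such that no cycle vertex is chosen more than \<open>k - 1\<close> times. The cycle together with
  the chosen edges, each doubled, is a \<open>k\<close>-walk: the degree of a cycle vertex is at most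
  \<open>2 + 2 (k - 1)\<close>, that of the other vertices is \<open>2\<close> (\<open>k_walk_of_cycle\<close>).

  Both constructions are local searches: in every state that is not final, some tuple of
  at most five vertices and indices describes an improving step, and a potential that is bounded by
  a polynomial drops with every step. For the matching this is achieved by an auction, in which an
  unassigned vertex takes over one of the cheapest slots offered by its neighbours and raises its
  price by one (locale \<open>hall\<close>). The program therefore consists of loops that run through all
  tuples and make every improving step they meet, repeated as often as the potential can drop.
  It uses only loops of \<open>n\<close> iterations each, so that it takes polynomial time whatever it computes
  (\<open>runs_com_of\<close>), and its correctness can be argued about the function on states that it denotes.
\<close>

section \<open>Adjacency and the forbidden subgraph\<close>

definition adj :: "'a graph \<Rightarrow> 'a \<Rightarrow> 'a \<Rightarrow> bool" where
  "adj G u v \<longleftrightarrow> {u, v} \<in> edges G"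

lemma adj_sym: "adj G u v \<longleftrightarrow> adj G v u"
  by (simp add: adj_def insert_commute)

lemma adj_verts:
  assumes "simple_graph G" "adj G u v"
  shows "u \<in> verts G" "v \<in> verts G" "u \<noteq> v"
  using assms by (auto simp: simple_graph_def adj_def)

text \<open>
  The form in which the hypothesis is used: two disjoint edges are joined by an edge.
\<close>

lemma two_K2_free_cross:
  assumes G: "simple_graph G" "two_K2_free G"
    and xy: "adj G x y" and uv: "adj G u v"
    and disj: "x \<noteq> u" "x \<noteq> v" "y \<noteq> u" "y \<noteq> v"
  shows "adj G x u \<or> adj G x v \<or> adj G y u \<or> adj G y v"
proof (rule ccontr)
  assume no: "\<not> ?thesis"
  define f :: "nat \<Rightarrow> 'a" where "f = (\<lambda>_. v)(0 := x, 1 := y, 2 := u)"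
  let ?S = "{x, y, u, v}"
  have d: "x \<noteq> y" "u \<noteq> v" and S: "?S \<subseteq> verts G"
    using adj_verts[OF G(1) xy] adj_verts[OF G(1) uv] by auto
  have f: "f 0 = x" "f (Suc 0) = y" "f 2 = u" "f 3 = v"
    by (simp_all add: f_def)
  have loops: "{w} \<notin> edges G" for w
    using adj_verts(3)[OF G(1), of w w] by (auto simp: adj_def)
  have "inj_on f (verts two_K2)"
    using d disj by (auto simp: inj_on_def two_K2_def f)
  moreover have "f ` verts two_K2 = verts (induced G ?S)"
    using S by (auto simp: two_K2_def induced_def f)
  ultimately have "bij_betw f (verts two_K2) (verts (induced G ?S))"
    by (simp add: bij_betw_def)
  moreover have "\<forall>a \<in> verts two_K2. \<forall>b \<in> verts two_K2.
      {a, b} \<in> edges two_K2 \<longleftrightarrow> {f a, f b} \<in> edges (induced G ?S)"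
    using no xy uv loops
    by (simp add: two_K2_def induced_def f doubleton_eq_iff adj_def insert_commute[of _ _ "{}"])
  ultimately have "graph_iso two_K2 (induced G ?S)"
    unfolding graph_iso_def by blast
  then show False
    using G(2) S unfolding two_K2_free_def by blast
qed

section \<open>Neighbourhoods in tough graphs\<close>

text \<open>
  The vertices of \<open>A\<close> are singleton components of the graph without \<open>S\<close>. The last
  hypothesis makes sure that there are at least two components, as toughness says nothing about
  fewer.
\<close>

lemma tough_isolated:
  assumes G: "simple_graph G" and k: "k \<ge> 2" and t: "tough (1 / (real k - 1)) G"
    and A: "A \<subseteq> verts G - S" and S: "S \<subseteq> verts G"
    and iso: "\<And>a b. a \<in> A \<Longrightarrow> adj G a b \<Longrightarrow> b \<in> S"
    and two: "card A \<ge> 2 \<or> A \<noteq> {} \<and> A \<noteq> verts G - S"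
  shows "card A \<le> (k - 1) * card S"
proof -
  let ?H = "delete_verts G S"
  let ?E = "{(x, y). {x, y} \<in> edges ?H}"
  have V: "verts ?H = verts G - S" by (auto simp: delete_verts_def induced_def)
  have fin: "finite (verts ?H)" using G V by (simp add: simple_graph_def)
  have isolated: "b = a" if "a \<in> A" "(a, b) \<in> ?E\<^sup>*" for a b
    using that(2)
  proof (cases rule: converse_rtranclE)
    case (step c)
    then have "adj G a c" "c \<notin> S" by (auto simp: delete_verts_def induced_def adj_def)
    then show ?thesis using iso that(1) by blast
  qed auto
  have cls: "reach ?H `` {a} = {a}" if "a \<in> A" for a
    using isolated[OF that] A that V by (auto simp: reach_def)
  have "(\<lambda>a. {a}) ` A \<subseteq> components ?H"
  proof
    fix X assume "X \<in> (\<lambda>a. {a}) ` A"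
    then obtain a where a: "a \<in> A" "X = {a}" by blast
    then show "X \<in> components ?H"
      using quotientI[of a "verts ?H" "reach ?H"] cls[OF a(1)] A V
      by (auto simp: components_def)
  qed
  moreover have finc: "finite (components ?H)"
    using fin by (auto simp: components_def quotient_def)
  moreover have cA: "card ((\<lambda>a. {a}) ` A) = card A" by (simp add: card_image)
  ultimately have le: "card A \<le> card (components ?H)" by (metis card_mono)
  have "card (components ?H) \<ge> 2"
  proof (cases "card A \<ge> 2")
    case True
    then show ?thesis using le by simp
  next
    case False
    then obtain b where b: "b \<in> verts ?H" "b \<notin> A" and ne: "A \<noteq> {}" using two A V by auto
    have "b \<in> reach ?H `` {b}" using b by (auto simp: reach_def)
    have "reach ?H `` {b} \<notin> (\<lambda>a. {a}) ` A"
    proof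
      assume "reach ?H `` {b} \<in> (\<lambda>a. {a}) ` A"
      then obtain a where "a \<in> A" and a: "reach ?H `` {b} = {a}" by (rule imageE)
      have "b = a" using \<open>b \<in> reach ?H `` {b}\<close> unfolding a by (rule singletonD)
      then show False using \<open>a \<in> A\<close> b(2) by simp
    qed
    moreover have "reach ?H `` {b} \<in> components ?H"
      using b by (auto simp: components_def intro: quotientI)
    ultimately have "(\<lambda>a. {a}) ` A \<subset> components ?H"
      using \<open>(\<lambda>a. {a}) ` A \<subseteq> components ?H\<close> by blast
    then have "card A < card (components ?H)" using psubset_card_mono[OF finc] cA by metis
    moreover have "card A > 0" using ne A V fin by (metis card_gt_0_iff finite_subset)
    ultimately show ?thesis by simp
  qed
  then have "\<not> real (card S) < real (card (components ?H)) * (1 / (real k - 1))"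
    using t S unfolding tough_def by blast
  then have "real (card (components ?H)) \<le> (real k - 1) * real (card S)"
    using k by (simp add: field_simps)
  also have "\<dots> = real ((k - 1) * card S)" using k by (simp add: of_nat_diff)
  finally show ?thesis using le by linarith
qed

text \<open>
  For a single vertex \<open>v\<close> the deletion of \<open>N(v)\<close> may leave just one component. Then it is enough that
  \<open>v\<close> has a neighbour, which toughness implies with \<open>S = {}\<close>, as there is a second vertex.
\<close>

lemma tough_neighbours:
  assumes G: "simple_graph G" and k: "k \<ge> 2" and t: "tough (1 / (real k - 1)) G"
    and n: "card (verts G) \<ge> 2"
    and A: "A \<subseteq> verts G" "A \<noteq> {}" and ind: "\<And>a b. a \<in> A \<Longrightarrow> adj G a b \<Longrightarrow> b \<notin> A"
  shows "card A \<le> (k - 1) * card {b. \<exists>a \<in> A. adj G a b}"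
proof -
  let ?S = "{b. \<exists>a \<in> A. adj G a b}"
  have S: "?S \<subseteq> verts G" using adj_verts[OF G] by blast
  have AS: "A \<subseteq> verts G - ?S" using A ind by auto
  have fin: "finite (verts G)" using G by (simp add: simple_graph_def)
  have fA: "finite A" and fS: "finite ?S" using A S fin by (auto intro: finite_subset)
  show ?thesis
  proof (cases "card A \<ge> 2 \<or> ?S = {}")
    case True
    have "card A \<ge> 2 \<or> A \<noteq> {} \<and> A \<noteq> verts G - ?S"
    proof (cases "card A \<ge> 2")
      case False
      then have "?S = {}" "A \<noteq> verts G" using True n by auto
      then show ?thesis using A by (metis Diff_empty)
    qed simp
    then show ?thesis
      by (intro tough_isolated[OF G k t AS S]) auto
  next
    case False
    then have "card A \<le> 1" "card ?S \<ge> 1" using fS by (auto simp: Suc_le_eq card_gt_0_iff)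
    moreover have "1 * 1 \<le> (k - 1) * card ?S" using k \<open>card ?S \<ge> 1\<close> by (intro mult_le_mono) auto
    ultimately show ?thesis by linarith
  qed
qed

section \<open>Cycles as successor functions\<close>

text \<open>
  A cycle is a vertex set \<open>C\<close> with a successor function, which is how the program stores it. That any
  vertex can be reached from any other by following successors forces the successor function to be a
  cyclic permutation of \<open>C\<close>. An edge traversed in both directions is a cycle of length two; a
  single vertex is not a cycle, since it is not adjacent to itself.
\<close>

definition steps :: "'a set \<Rightarrow> ('a \<Rightarrow> 'a) \<Rightarrow> ('a \<times> 'a) set" where
  "steps C f = {(c, f c) |c. c \<in> C}"

definition is_cycle :: "'a graph \<Rightarrow> 'a set \<Rightarrow> ('a \<Rightarrow> 'a) \<Rightarrow> bool" where
  "is_cycle G C f \<longleftrightarrow> C \<noteq> {} \<and> C \<subseteq> verts G \<and> (\<forall>c \<in> C. f c \<in> C \<and> adj G c (f c)) \<and>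
     (\<forall>a \<in> C. \<forall>b \<in> C. (a, b) \<in> (steps C f)\<^sup>*)"

lemma is_cycle_image:
  assumes G: "simple_graph G" and c: "is_cycle G C f"
  shows "f ` C = C"
proof
  show "f ` C \<subseteq> C" using c by (auto simp: is_cycle_def)
  show "C \<subseteq> f ` C"
  proof
    fix b assume b: "b \<in> C"
    have fb: "f b \<in> C" "f b \<noteq> b"
      using c b adj_verts(3)[OF G, of b "f b"] by (auto simp: is_cycle_def)
    then have "(f b, b) \<in> (steps C f)\<^sup>*" using c b by (auto simp: is_cycle_def)
    then show "b \<in> f ` C"
      using fb(2) by (cases rule: rtranclE) (auto simp: steps_def)
  qed
qed

lemma is_cycle_inj:
  assumes G: "simple_graph G" and c: "is_cycle G C f"
  shows "inj_on f C"
proof -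
  have "finite C" using G c by (auto simp: simple_graph_def is_cycle_def intro: finite_subset)
  then show ?thesis
    using is_cycle_image[OF G c] by (simp add: eq_card_imp_inj_on)
qed

definition splice :: "('a \<Rightarrow> 'a) \<Rightarrow> 'a \<Rightarrow> 'a \<Rightarrow> 'a \<Rightarrow> 'a \<Rightarrow> 'a \<Rightarrow> 'a \<Rightarrow> 'a" where
  "splice f u p q r v = f(p := q, q := r, r := v, u := p)"

text \<open>
  The paths with one, two or three vertices, written as triples: \<open>(x, x, x)\<close>, \<open>(x, x, y)\<close> or
  \<open>(x, y, y)\<close>, and \<open>(x, y, z)\<close>. The order of the updates in \<open>splice\<close> is chosen such that it is right
  for all of these: the entries written for repeated vertices are overwritten by the last one.
\<close>

definition weak_path :: "'a graph \<Rightarrow> 'a \<Rightarrow> 'a \<Rightarrow> 'a \<Rightarrow> bool" where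
  "weak_path G p q r \<longleftrightarrow> (p = q \<or> adj G p q) \<and> (q = r \<or> adj G q r) \<and> (p = r \<longrightarrow> p = q)"

text \<open>
  Paths of the old cycle between vertices that stay survive, with the detour over \<open>p, q, r\<close> in place
  of the steps from \<open>u\<close> to \<open>v\<close>. As the argument is the same whether \<open>v\<close> is one or two steps after
  \<open>u\<close>, insertion (\<open>D = C\<close>) and exchange, where the vertex between them is dropped, are treated together.
\<close>

lemma is_cycle_splice:
  assumes G: "simple_graph G" and cyc: "is_cycle G C f" and u: "u \<in> C"
    and out: "p \<in> verts G - C" "q \<in> verts G - C" "r \<in> verts G - C"
    and path: "weak_path G p q r" and up: "adj G u p" and rv: "adj G r v"
    and D: "D = C \<and> v = f u \<or> D = C - {f u} \<and> v = f (f u)"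
  shows "is_cycle G (D \<union> {p, q, r}) (splice f u p q r v)"
proof -
  let ?C = "D \<union> {p, q, r}" and ?f = "splice f u p q r v"
  let ?R = "(steps ?C ?f)\<^sup>*"
  have maps: "f c \<in> C \<and> adj G c (f c) \<and> f c \<noteq> c" if "c \<in> C" for c
    using cyc adj_verts(3)[OF G, of c "f c"] that by (auto simp: is_cycle_def)
  have inj: "inj_on f C" by (rule is_cycle_inj[OF G cyc])
  have DC: "D \<subseteq> C" and uD: "u \<in> D" and vD: "v \<in> D"
    using D u maps[OF u] maps[of "f u"] by auto
  have f_old: "?f c = f c" if "c \<in> D" "c \<noteq> u" for c
    using that out DC by (auto simp: splice_def)
  have step: "(c, ?f c) \<in> ?R" if "c \<in> ?C" for c
    using that by (auto simp: steps_def)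
  have fu: "?f u = p" by (simp add: splice_def)
  have un: "u \<noteq> p" "u \<noteq> q" "u \<noteq> r" using out u by auto
  have fr: "?f r = v" using un by (auto simp: splice_def)
  have fp: "p = q \<or> ?f p = q" using un path by (auto simp: splice_def weak_path_def)
  have fq: "q = r \<or> ?f q = r" using un path by (auto simp: splice_def weak_path_def)
  have R_up: "(u, p) \<in> ?R" using step[of u] uD fu by auto
  have R_pq: "(p, q) \<in> ?R" using step[of p] fp by auto
  have R_qr: "(q, r) \<in> ?R" using step[of q] fq by auto
  have R_rv: "(r, v) \<in> ?R" using step[of r] fr by auto
  have R_uq: "(u, q) \<in> ?R" and R_ur: "(u, r) \<in> ?R" and R_uv: "(u, v) \<in> ?R"
    and R_qv: "(q, v) \<in> ?R" and R_pv: "(p, v) \<in> ?R"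
    using R_up R_pq R_qr R_rv by (meson rtrancl_trans)+
  \<comment> \<open>A path of the old cycle that ends in a dropped vertex is shortened to end at \<open>u\<close>.\<close>
  have old: "(b \<in> D \<longrightarrow> (a, b) \<in> ?R) \<and> (b \<notin> D \<longrightarrow> (a, u) \<in> ?R)"
    if a: "a \<in> D" and ab: "(a, b) \<in> (steps C f)\<^sup>*" for a b
    using ab
  proof (induction rule: rtrancl_induct)
    case base
    then show ?case using a by simp
  next
    case (step b c)
    then have b: "b \<in> C" and c: "c = f b" by (auto simp: steps_def)
    consider "b \<notin> D" | "b = u" | "b \<in> D" "b \<noteq> u" by blast
    then show ?case
    proof cases
      case 1
      then have "c = v" using D b c by auto
      moreover have "(a, u) \<in> ?R" using step 1 by simp
      ultimately show ?thesis using R_uv vD by (auto intro: rtrancl_trans)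
    next
      case 2
      then have "(a, u) \<in> ?R" using step uD by simp
      moreover have "c \<in> D \<Longrightarrow> c = v" using 2 c D by auto
      ultimately show ?thesis using R_uv by (auto intro: rtrancl_trans)
    next
      case 3
      then have "(b, c) \<in> ?R" using \<open>\<And>c. c \<in> ?C \<Longrightarrow> (c, ?f c) \<in> ?R\<close>[of b] f_old c by auto
      moreover have "(a, b) \<in> ?R" using 3 step by simp
      moreover have "c \<in> D"
        using D c b u 3 maps inj by (auto dest: inj_onD)
      ultimately show ?thesis by (auto intro: rtrancl_trans)
    qed
  qed
  have R_D: "(a, b) \<in> ?R" if "a \<in> D" "b \<in> D" for a b
    using old[of a b] that DC cyc unfolding is_cycle_def by blast
  have to_u: "(a, u) \<in> ?R" if "a \<in> ?C" for a
    using that R_D[OF _ uD] R_pv R_qv R_rv R_D[OF vD uD] by (auto intro: rtrancl_trans)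
  have from_u: "(u, a) \<in> ?R" if "a \<in> ?C" for a
    using that R_D[OF uD] R_up R_uq R_ur by auto
  have "?f c \<in> ?C \<and> adj G c (?f c)" if c: "c \<in> ?C" for c
  proof (cases "c \<in> D \<and> c \<noteq> u")
    case True
    then have "f c \<in> D" using D maps inj u DC by (auto dest: inj_onD)
    then show ?thesis using True f_old maps DC by auto
  next
    case False
    then have "c = u \<or> c = p \<or> c = q \<or> c = r" using c by blast
    then show ?thesis
      using fu fr up rv vD path un by (auto simp: splice_def weak_path_def)
  qed
  moreover have "(a, b) \<in> ?R" if "a \<in> ?C" "b \<in> ?C" for a b
    using to_u[OF that(1)] from_u[OF that(2)] by (rule rtrancl_trans)
  moreover have "?C \<subseteq> verts G" using DC cyc out by (auto simp: is_cycle_def)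
  ultimately show ?thesis by (auto simp: is_cycle_def)
qed

lemma edge_is_cycle:
  assumes G: "simple_graph G" and uv: "adj G u v" and f: "f u = v" "f v = u"
  shows "is_cycle G {u, v} f"
proof -
  have "(u, v) \<in> (steps {u, v} f)\<^sup>*" "(v, u) \<in> (steps {u, v} f)\<^sup>*"
    using f by (auto simp: steps_def)
  then show ?thesis
    using f uv adj_verts[OF G uv] by (auto simp: is_cycle_def adj_sym)
qed

lemma has_edge:
  assumes "simple_graph G" "k \<ge> 2" "tough (1 / (real k - 1)) G" "card (verts G) \<ge> 2"
  shows "\<exists>u v. adj G u v"
proof (rule ccontr)
  assume no: "\<not> ?thesis"
  obtain a where "a \<in> verts G" using assms(1) by (auto simp: simple_graph_def)
  then have "card {a} \<le> (k - 1) * card {b. \<exists>a' \<in> {a}. adj G a' b}"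
    using no by (intro tough_neighbours[OF assms]) auto
  moreover have "{b. \<exists>a' \<in> {a}. adj G a' b} = {}" using no by blast
  ultimately show False by (simp only: card.empty) simp
qed

section \<open>Dominating cycles\<close>

definition outer_edges :: "'a graph \<Rightarrow> 'a set \<Rightarrow> ('a \<times> 'a) set" where
  "outer_edges G C = {(x, y). x \<in> verts G - C \<and> y \<in> verts G - C \<and> adj G x y}"

lemma finite_outer_edges: "simple_graph G \<Longrightarrow> finite (outer_edges G C)"
  by (rule finite_subset[of _ "verts G \<times> verts G"])
    (auto simp: outer_edges_def simple_graph_def)

text \<open>
  The vertex \<open>y\<close> witnesses that \<open>p\<close> is incident with an edge outside the cycle, so that moving \<open>p\<close> onto
  the cycle is progress.
\<close>

definition can_splice :: "'a graph \<Rightarrow> 'a set \<Rightarrow> 'a \<Rightarrow> 'a \<Rightarrow> 'a \<Rightarrow> 'a \<Rightarrow> 'a \<Rightarrow> bool" where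
  "can_splice G C u p q r y \<longleftrightarrow> u \<in> C \<and> {p, q, r, y} \<subseteq> verts G - C \<and>
     weak_path G p q r \<and> adj G u p \<and> adj G p y"

definition closed_in :: "'a graph \<Rightarrow> 'a set \<Rightarrow> 'a \<Rightarrow> bool" where
  "closed_in G C w \<longleftrightarrow> (\<forall>z \<in> verts G - C. \<not> adj G w z)"

text \<open>
  A vertex that leaves the cycle contributes no outer edge, because it has no neighbours outside.
\<close>

lemma outer_edges_splice:
  assumes G: "simple_graph G" and s: "can_splice G C u p q r y"
    and D: "D = C \<or> D = C - {w} \<and> closed_in G C w"
  shows "card (outer_edges G (D \<union> {p, q, r})) < card (outer_edges G C)"
proof (rule psubset_card_mono)
  show "finite (outer_edges G C)" using G by (rule finite_outer_edges)
  have "outer_edges G (D \<union> {p, q, r}) \<subseteq> outer_edges G C"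
    using D adj_verts(3)[OF G] by (auto simp: outer_edges_def closed_in_def adj_sym)
  moreover have "(p, y) \<in> outer_edges G C - outer_edges G (D \<union> {p, q, r})"
    using s by (auto simp: outer_edges_def can_splice_def)
  ultimately show "outer_edges G (D \<union> {p, q, r}) \<subset> outer_edges G C" by blast
qed

text \<open>
  Call a cycle vertex near if it is adjacent to an end of the given outer edge \<open>xy\<close>. By
  \<open>two_K2_free_cross\<close> one of any two consecutive vertices is near. If no path can be inserted, then
  never are both, so for a near vertex \<open>u\<close> the vertex \<open>w\<close> after it is not near and the next one is;
  it remains to see that \<open>w\<close> may leave the cycle.
\<close>

lemma splice_exists:
  assumes G: "simple_graph G" "two_K2_free G" and cyc: "is_cycle G C f"
    and ne: "outer_edges G C \<noteq> {}"
  shows "\<exists>u p q r y. can_splice G C u p q r y \<and>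
    (adj G r (f u) \<or> closed_in G C (f u) \<and> adj G r (f (f u)))"
proof (rule ccontr)
  assume no: "\<not> ?thesis"
  obtain x y where xy: "x \<in> verts G - C" "y \<in> verts G - C" "adj G x y"
    using ne by (auto simp: outer_edges_def)
  have maps: "\<And>c. c \<in> C \<Longrightarrow> f c \<in> C \<and> adj G c (f c)"
    using cyc by (auto simp: is_cycle_def)
  define near where "near c \<longleftrightarrow> adj G x c \<or> adj G y c" for c
  have one: "near c \<or> near (f c)" if "c \<in> C" for c
    using two_K2_free_cross[OF G xy(3), of c "f c"] maps[OF that] xy that
    by (auto simp: near_def)
  have nearD: "\<exists>a \<in> {x, y}. adj G c a \<and> adj G a c" if "near c" for c
    using that by (auto simp: near_def adj_def insert_commute)
  have pair: "\<exists>a b. {a, b} \<subseteq> {x, y} \<and> adj G c a \<and> adj G b c'" if "near c" "near c'" for c c'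
    using nearD[OF that(1)] nearD[OF that(2)] by blast
  have xy': "\<exists>d \<in> {x, y}. adj G a d" if "a \<in> {x, y}" for a
    using xy(3) that by (auto simp: adj_sym)
  have wp: "weak_path G a a b" if "{a, b} \<subseteq> {x, y}" for a b
    using that xy(3) by (auto simp: weak_path_def adj_sym)
  have alt: "\<not> near (f c)" if c: "c \<in> C" "near c" for c
  proof
    assume "near (f c)"
    from pair[OF c(2) this] obtain a b
      where ab: "{a, b} \<subseteq> {x, y}" "adj G c a" "adj G b (f c)" by blast
    moreover obtain d where "d \<in> {x, y}" "adj G a d" using ab(1) xy'[of a] by blast
    ultimately have "can_splice G C c a a b d"
      using c xy wp[of a b] by (auto simp: can_splice_def)
    then show False using no ab by blast
  qed
  obtain u where u: "u \<in> C" "near u"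
    using one cyc maps by (metis ex_in_conv is_cycle_def)
  let ?w = "f u"
  have w: "?w \<in> C" "\<not> near ?w" "near (f ?w)" using u alt one maps by auto
  from pair[OF u(2) w(3)] obtain a b
    where ab: "{a, b} \<subseteq> {x, y}" "adj G u a" "adj G b (f ?w)" by blast
  have "closed_in G C ?w"
    unfolding closed_in_def
  proof (intro ballI notI)
    \<comment> \<open>A neighbour of \<open>w\<close> outside could be reached from \<open>xy\<close>, and a path from it to the
      vertex after \<open>w\<close> could be inserted.\<close>
    fix z assume z: "z \<in> verts G - C" "adj G ?w z"
    then have "z \<noteq> x" "z \<noteq> y" using w by (auto simp: near_def adj_sym)
    then obtain d where d: "d \<in> {x, y}" "adj G z d"
      using two_K2_free_cross[OF G xy(3) z(2)] w xy by (auto simp: near_def adj_sym)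
    have "weak_path G z d b"
      using d ab xy(3) \<open>z \<noteq> x\<close> \<open>z \<noteq> y\<close> by (auto simp: weak_path_def adj_sym)
    then have "can_splice G C ?w z d b d"
      using z d ab xy w by (auto simp: can_splice_def)
    then show False using no ab by blast
  qed
  moreover obtain d where "d \<in> {x, y}" "adj G a d" using ab(1) xy'[of a] by blast
  then have "can_splice G C u a a b d"
    using ab u xy wp[of a b] by (auto simp: can_splice_def)
  ultimately show False using no ab by blast
qed

lemma dominating_cycle_exists:
  assumes G: "simple_graph G" "two_K2_free G" and cyc: "is_cycle G C f"
  shows "\<exists>C f. is_cycle G C f \<and> outer_edges G C = {}"
  using cyc
proof (induction "card (outer_edges G C)" arbitrary: C f rule: less_induct)
  case less
  show ?case
  proof (cases "outer_edges G C = {}")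
    case True
    then show ?thesis using less.prems by blast
  next
    case False
    then obtain u p q r y where s: "can_splice G C u p q r y"
      and alt: "adj G r (f u) \<or> closed_in G C (f u) \<and> adj G r (f (f u))"
      using splice_exists[OF G less.prems] by blast
    define D where "D = (if adj G r (f u) then C else C - {f u})"
    define v where "v = (if adj G r (f u) then f u else f (f u))"
    have "is_cycle G (D \<union> {p, q, r}) (splice f u p q r v)"
      using s alt by (intro is_cycle_splice[OF G(1) less.prems])
        (auto simp: can_splice_def D_def v_def)
    moreover have "card (outer_edges G (D \<union> {p, q, r})) < card (outer_edges G C)"
      using alt by (intro outer_edges_splice[OF G(1) s]) (auto simp: D_def)
    ultimately show ?thesis using less.hyps by blast
  qed
qed

section \<open>Bipartite matching by auction\<close>

text \<open>
  A bipartite graph between \<open>I\<close> and \<open>S\<close> that satisfies Hall's condition, and a matching algorithm for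
  it without augmenting paths: each slot in \<open>S\<close> has a price, and an unserved vertex takes a
  cheapest slot among its neighbours, evicts the occupant and raises the price by one. As only one
  entry of each table changes, the step can be found and made by simple loops.
\<close>

locale hall =
  fixes I :: "'v set" and S :: "'s set" and nb :: "'v \<Rightarrow> 's set"
  assumes finite_I: "finite I" and finite_S: "finite S"
    and nb_S: "v \<in> I \<Longrightarrow> nb v \<subseteq> S"
    and hall: "A \<subseteq> I \<Longrightarrow> A \<noteq> {} \<Longrightarrow> card A \<le> card (\<Union>v\<in>A. nb v)"
begin

definition served :: "('s \<Rightarrow> 'v option) \<Rightarrow> 'v \<Rightarrow> bool" where
  "served B v \<longleftrightarrow> (\<exists>s. B s = Some v)"

text \<open>
  The invariant of the auction. That nobody overpays by more than one is what connects consecutive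
  price levels in \<open>price_bound\<close>. An occupied slot never becomes empty again, so a slot with a positive
  price has an occupant.
\<close>

definition fair :: "('s \<Rightarrow> 'v option) \<Rightarrow> ('s \<Rightarrow> nat) \<Rightarrow> bool" where
  "fair B L \<longleftrightarrow>
     (\<forall>s v. B s = Some v \<longrightarrow> v \<in> I \<and> s \<in> nb v \<and> (\<forall>t \<in> nb v. L s \<le> L t + 1)) \<and>
     (\<forall>s t v. B s = Some v \<longrightarrow> B t = Some v \<longrightarrow> s = t) \<and>
     (\<forall>s \<in> S. L s > 0 \<longrightarrow> B s \<noteq> None) \<and>
     (\<forall>s \<in> S. L s \<le> card S)"

lemma fair_init: "fair (\<lambda>_. None) (\<lambda>_. 0)"
  by (simp add: fair_def)

definition cheapest :: "('s \<Rightarrow> nat) \<Rightarrow> 'v \<Rightarrow> 's \<Rightarrow> bool" where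
  "cheapest L v s \<longleftrightarrow> s \<in> nb v \<and> (\<forall>t \<in> nb v. L s \<le> L t)"

lemma cheapest_exists:
  assumes v: "v \<in> I"
  shows "\<exists>s. cheapest L v s"
proof -
  have "nb v \<noteq> {}" using hall[of "{v}"] v by (auto simp: card_gt_0_iff)
  moreover have "finite (nb v)" using nb_S[OF v] finite_S by (rule finite_subset)
  ultimately have "arg_min_on L (nb v) \<in> nb v" "\<forall>t \<in> nb v. L (arg_min_on L (nb v)) \<le> L t"
    by (simp_all add: arg_min_if_finite(1) arg_min_least)
  then show ?thesis unfolding cheapest_def by blast
qed

text \<open>
  This is what bounds the number of bids. Let \<open>j\<close> be at most the cheapest price available
  to the unserved vertex \<open>v\<close>, and suppose that no slot has price \<open>j\<close>. The slots of price greater than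
  \<open>j\<close> are occupied, and by fairness their occupants, like \<open>v\<close> itself, have only
  neighbours of price at least \<open>j\<close>, hence greater than \<open>j\<close>. So these vertices outnumber their
  neighbourhood, against Hall's condition. Hence every price up to the cheapest one occurs, and
  there are at most as many prices as slots.
\<close>

lemma price_bound:
  assumes fair: "fair B L" and v: "v \<in> I" "\<not> served B v" and s: "cheapest L v s"
  shows "L s < card S"
proof -
  have levels: "\<exists>t \<in> S. L t = j" if j: "j \<le> L s" for j
  proof (rule ccontr)
    assume none: "\<not> ?thesis"
    define A where "A = {w \<in> I. \<forall>t \<in> nb w. j \<le> L t}"
    define H where "H = {t \<in> S. j < L t}"
    have vA: "v \<in> A" using v s j by (auto simp: A_def cheapest_def)
    have "(\<Union>w\<in>A. nb w) \<subseteq> H"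
    proof
      fix t assume "t \<in> (\<Union>w\<in>A. nb w)"
      then have "t \<in> S" "j \<le> L t" using nb_S by (auto simp: A_def)
      then show "t \<in> H" using none by (auto simp: H_def le_less)
    qed
    then have "card (\<Union>w\<in>A. nb w) \<le> card H"
      using finite_S by (intro card_mono) (auto simp: H_def)
    moreover have "card A \<le> card (\<Union>w\<in>A. nb w)"
      using vA by (intro hall) (auto simp: A_def)
    ultimately have "card A \<le> card H" by simp
    moreover have "card H < card A"
    proof -
      have occ: "\<exists>w. B t = Some w \<and> w \<in> A - {v}" if t: "t \<in> H" for t
      proof -
        have "t \<in> S" "0 < L t" using t by (auto simp: H_def)
        then obtain w where w: "B t = Some w" using fair unfolding fair_def by blast
        then have "w \<in> I" "\<forall>t' \<in> nb w. L t \<le> L t' + 1" "w \<noteq> v"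
          using fair v by (auto simp: fair_def served_def)
        moreover have "j \<le> L t'" if "t' \<in> nb w" for t'
          using t \<open>\<forall>t' \<in> nb w. L t \<le> L t' + 1\<close> that by (auto simp: H_def dest!: bspec)
        ultimately show ?thesis using w by (auto simp: A_def)
      qed
      have "inj_on (\<lambda>t. the (B t)) H"
      proof (rule inj_onI)
        fix t t' assume "t \<in> H" "t' \<in> H" "the (B t) = the (B t')"
        then obtain w where "B t = Some w" "B t' = Some w" using occ by (metis option.sel)
        then show "t = t'" using fair unfolding fair_def by blast
      qed
      moreover have "(\<lambda>t. the (B t)) ` H \<subseteq> A - {v}" using occ by (metis image_subsetI option.sel)
      moreover have fA: "finite A" using finite_I by (simp add: A_def)
      ultimately have "card H \<le> card (A - {v})" by (auto intro: card_inj_on_le)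
      also have "\<dots> < card A" using fA vA by (rule card_Diff1_less)
      finally show ?thesis .
    qed
    ultimately show False by simp
  qed
  then have "{..L s} \<subseteq> L ` S" by force
  then have "card {..L s} \<le> card (L ` S)" using finite_S by (intro card_mono) auto
  also have "\<dots> \<le> card S" using finite_S by (rule card_image_le)
  finally show ?thesis by simp
qed

lemma fair_bid:
  assumes fair: "fair B L" and v: "v \<in> I" "\<not> served B v" and s: "cheapest L v s"
  shows "fair (B(s := Some v)) (L(s := L s + 1))"
  using assms price_bound[OF assms]
  unfolding fair_def cheapest_def served_def
  by (auto simp: le_SucI)

text \<open>
  The total by which the prices can still rise. Making it zero once all vertices are
  served lets it vanish exactly when a fair auction is over.
\<close>

definition slack :: "('s \<Rightarrow> 'v option) \<Rightarrow> ('s \<Rightarrow> nat) \<Rightarrow> nat" where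
  "slack B L = (if \<forall>v \<in> I. served B v then 0 else \<Sum>s\<in>S. card S - L s)"

lemma slack_bid:
  assumes fair: "fair B L" and v: "v \<in> I" "\<not> served B v" and s: "cheapest L v s"
  shows "slack (B(s := Some v)) (L(s := L s + 1)) < slack B L"
proof -
  have sS: "s \<in> S" using s v nb_S by (auto simp: cheapest_def)
  have "(\<Sum>t\<in>S. card S - (L(s := L s + 1)) t) < (\<Sum>t\<in>S. card S - L t)"
    using price_bound[OF assms] sS
    by (intro sum_strict_mono_ex1 finite_S) (auto intro!: bexI[of _ s])
  then show ?thesis using v by (auto simp: slack_def)
qed

lemma slack_0D:
  assumes "fair B L" "slack B L = 0" "v \<in> I"
  shows "served B v"
proof (rule ccontr)
  assume "\<not> served B v"
  moreover obtain s where "cheapest L v s" using cheapest_exists assms(3) by blast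
  ultimately have "slack (B(s := Some v)) (L(s := L s + 1)) < slack B L"
    using assms by (intro slack_bid)
  then show False using assms(2) by simp
qed

lemma slack_le: "slack B L \<le> card S * card S"
proof -
  have "(\<Sum>s\<in>S. card S - L s) \<le> (\<Sum>s\<in>S. card S)" by (intro sum_mono) simp
  then show ?thesis by (simp add: slack_def)
qed

lemma served_all_exists: "\<exists>B L. fair B L \<and> (\<forall>v \<in> I. served B v)"
proof -
  have "\<exists>B' L'. fair B' L' \<and> (\<forall>v \<in> I. served B' v)" if "fair B L" for B L
    using that
  proof (induction "slack B L" arbitrary: B L rule: less_induct)
    case less
    show ?case
    proof (cases "\<forall>v \<in> I. served B v")
      case True
      then show ?thesis using less by blast
    next
      case False
      then obtain v where v: "v \<in> I" "\<not> served B v" by blast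
      obtain s where s: "cheapest L v s" using cheapest_exists v by blast
      show ?thesis
        using less.hyps[OF slack_bid fair_bid] less.prems v s by blast
    qed
  qed
  then show ?thesis using fair_init by blast
qed

end

section \<open>From a dominating cycle and an assignment to a walk\<close>

definition walk_edges :: "'a set \<Rightarrow> ('a \<Rightarrow> 'a) \<Rightarrow> 'a set \<Rightarrow> ('a \<Rightarrow> 'a) \<Rightarrow> 'a set multiset" where
  "walk_edges C f I m = image_mset (\<lambda>c. {c, f c}) (mset_set C) +
     (image_mset (\<lambda>v. {v, m v}) (mset_set I) + image_mset (\<lambda>v. {v, m v}) (mset_set I))"

lemma size_filter_image_mset_set:
  "finite A \<Longrightarrow> size (filter_mset P (image_mset g (mset_set A))) = card {a \<in> A. P (g a)}"
  by (simp add: filter_mset_image_mset)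

lemma count_image_mset_set:
  "finite A \<Longrightarrow> count (image_mset g (mset_set A)) y = card {a \<in> A. g a = y}"
  using size_filter_image_mset_set[of A "\<lambda>x. x = y" g] by (simp add: filter_eq_replicate_mset)

lemma count_size_le: "count M x \<le> size M"
  by (induction M) auto

text \<open>
  A cycle vertex has degree two from the cycle and two for each vertex that is attached to it. The
  multiplicity of an edge is at most the degree of its ends, which gives the bound \<open>2k\<close>.
\<close>

lemma k_walk_of_cycle:
  assumes G: "simple_graph G" and cyc: "is_cycle G C f" and I: "I = verts G - C"
    and m: "\<And>v. v \<in> I \<Longrightarrow> m v \<in> C \<and> adj G v (m v)"
    and load: "\<And>c. c \<in> C \<Longrightarrow> card {v \<in> I. m v = c} \<le> k - 1" and k: "k \<ge> 1"
  shows "k_walk k G \<lparr>mverts = verts G, medges = walk_edges C f I m\<rparr>"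
proof -
  let ?M = "walk_edges C f I m"
  let ?W = "\<lparr>mverts = verts G, medges = ?M\<rparr>"
  have fin: "finite (verts G)" using G by (simp add: simple_graph_def)
  have C: "C \<subseteq> verts G" "C \<noteq> {}" using cyc by (auto simp: is_cycle_def)
  have finC: "finite C" and finI: "finite I"
    using fin C(1) I by (auto intro: finite_subset)
  have maps: "f c \<in> C \<and> adj G c (f c) \<and> f c \<noteq> c" if "c \<in> C" for c
    using cyc adj_verts(3)[OF G, of c "f c"] that by (auto simp: is_cycle_def)
  have deg: "mdegree ?W v = card {c \<in> C. v = c \<or> v = f c} + 2 * card {w \<in> I. v = w \<or> v = m w}" for v
    using finC finI
    by (simp add: mdegree_def walk_edges_def size_filter_image_mset_set)
  have deg_C: "mdegree ?W v = 2 + 2 * card {w \<in> I. m w = v}" if v: "v \<in> C" for v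
  proof -
    have "v \<in> f ` C" using is_cycle_image[OF G cyc] v by simp
    then obtain b where b: "b \<in> C" "f b = v" by auto
    have "{c \<in> C. v = f c} = {b}"
    proof (intro equalityI subsetI)
      fix c assume "c \<in> {c \<in> C. v = f c}"
      then show "c \<in> {b}" using inj_onD[OF is_cycle_inj[OF G cyc], of c b] b by simp
    qed (use b in auto)
    moreover have "{c \<in> C. v = c \<or> v = f c} = insert v {c \<in> C. v = f c}" using v by blast
    ultimately have "{c \<in> C. v = c \<or> v = f c} = {v, b}" by simp
    moreover have "b \<noteq> v" using maps[OF v] b by auto
    moreover have "{w \<in> I. v = w \<or> v = m w} = {w \<in> I. m w = v}" using v I by auto
    ultimately show ?thesis using deg[of v] by simp
  qed
  have deg_I: "mdegree ?W v = 2" if v: "v \<in> I" for v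
  proof -
    have "{c \<in> C. v = c \<or> v = f c} = {}" using v I maps by auto
    then have "card {c \<in> C. v = c \<or> v = f c} = 0" by (simp only: card.empty)
    moreover have "{w \<in> I. v = w \<or> v = m w} = {v}" using v I m by auto
    ultimately show ?thesis using deg[of v] by simp
  qed
  have deg_ok: "even (mdegree ?W v) \<and> mdegree ?W v \<le> 2 * k" if v: "v \<in> verts G" for v
  proof (cases "v \<in> C")
    case True
    then show ?thesis using deg_C[OF True] load[OF True] k by simp
  next
    case False
    then show ?thesis using deg_I[of v] v I k by simp
  qed
  have edges: "e \<in> edges G" if "e \<in># ?M" for e
    using that finC finI maps m by (auto simp: walk_edges_def adj_def)
  have "?M \<subseteq># repeat_mset (2 * k) (mset_set (edges G))"
  proof (rule mset_subset_eqI)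
    fix e
    show "count ?M e \<le> count (repeat_mset (2 * k) (mset_set (edges G))) e"
    proof (cases "e \<in># ?M")
      case True
      then have e: "e \<in> edges G" by (rule edges)
      then have "e \<subseteq> verts G" "e \<noteq> {}" using G by (auto simp: simple_graph_def)
      then obtain x where x: "x \<in> e" "x \<in> verts G" by blast
      have "count ?M e = count {#e' \<in># ?M. x \<in> e'#} e" using x by simp
      also have "\<dots> \<le> size {#e' \<in># ?M. x \<in> e'#}" by (rule count_size_le)
      also have "\<dots> = mdegree ?W x" by (simp add: mdegree_def)
      also have "\<dots> \<le> 2 * k" using deg_ok x by simp
      finally have "count ?M e \<le> 2 * k" .
      moreover have "finite (edges G)"
      proof (rule finite_subset)
        show "edges G \<subseteq> Pow (verts G)" using G unfolding simple_graph_def by blast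
        show "finite (Pow (verts G))" using fin by simp
      qed
      ultimately show ?thesis using e by simp
    qed (simp add: not_in_iff)
  qed
  then have span: "spanning_subgraph ?W (times_graph (2 * k) G)"
    by (simp add: spanning_subgraph_def times_graph_def)
  let ?E = "{(x, y). {x, y} \<in> set_mset ?M}"
  have sub: "steps C f \<subseteq> ?E" using finC by (auto simp: steps_def walk_edges_def)
  have EC: "(a, b) \<in> ?E\<^sup>*" if "a \<in> C" "b \<in> C" for a b
    using rtrancl_mono[OF sub] cyc that unfolding is_cycle_def by blast
  have near: "\<exists>c \<in> C. (v, c) \<in> ?E\<^sup>* \<and> (c, v) \<in> ?E\<^sup>*" if v: "v \<in> verts G" for v
  proof (cases "v \<in> C")
    case True
    then show ?thesis by blast
  next
    case False
    then have "v \<in> I" using v I by simp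
    then have "(v, m v) \<in> ?E" "(m v, v) \<in> ?E" "m v \<in> C"
      using m finI by (auto simp: walk_edges_def insert_commute)
    then show ?thesis by blast
  qed
  have "(a, b) \<in> ?E\<^sup>*" if "a \<in> verts G" "b \<in> verts G" for a b
    using near[OF that(1)] near[OF that(2)] EC by (meson rtrancl_trans)
  then have "mconnected ?W"
    using C by (auto simp: mconnected_def connected_graph_def reach_def)
  then show ?thesis using span deg_ok by (simp add: k_walk_def)
qed

lemma k_walk_single_vertex:
  assumes "simple_graph G" "card (verts G) = 1"
  shows "k_walk k G \<lparr>mverts = verts G, medges = {#}\<rparr>"
  using assms by (auto simp: k_walk_def spanning_subgraph_def times_graph_def mconnected_def
      connected_graph_def reach_def mdegree_def card_1_singleton_iff)

text \<open>
  Each vertex offers \<open>k - 1\<close> slots, but at most as many as there are vertices: more cannot be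
  needed, and the running time must not depend on \<open>k\<close>. For simplicity all vertices offer
  slots, but only those on a dominating cycle are adjacent to a vertex outside it.
\<close>

definition slots :: "nat \<Rightarrow> 'a graph \<Rightarrow> ('a \<times> nat) set" where
  "slots k G = verts G \<times> {..<min (card (verts G)) (k - 1)}"

definition slots_near :: "nat \<Rightarrow> 'a graph \<Rightarrow> 'a \<Rightarrow> ('a \<times> nat) set" where
  "slots_near k G v = {c. adj G v c} \<times> {..<min (card (verts G)) (k - 1)}"

lemma outside_neighbour:
  assumes "simple_graph G" "outer_edges G C = {}" "v \<in> verts G - C" "adj G v c"
  shows "c \<in> C"
  using assms adj_verts[OF assms(1,4)] by (auto simp: outer_edges_def)

lemma hall_slots:
  assumes G: "simple_graph G" and k: "k \<ge> 2" and t: "tough (1 / (real k - 1)) G"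
    and n: "card (verts G) \<ge> 2" and dom: "outer_edges G C = {}"
  shows "hall (verts G - C) (slots k G) (slots_near k G)"
proof
  have fin: "finite (verts G)" using G by (simp add: simple_graph_def)
  then show "finite (verts G - C)" "finite (slots k G)" by (auto simp: slots_def)
  show "slots_near k G v \<subseteq> slots k G" for v
    using adj_verts[OF G] by (auto simp: slots_def slots_near_def)
  fix A assume A: "A \<subseteq> verts G - C" "A \<noteq> {}"
  let ?B = "{b. \<exists>a \<in> A. adj G a b}"
  have le: "card A \<le> (k - 1) * card ?B"
  proof (rule tough_neighbours[OF G k t n])
    show "A \<subseteq> verts G" using A by auto
    show "b \<notin> A" if "a \<in> A" "adj G a b" for a b
      using outside_neighbour[OF G dom, of a b] that A by auto
  qed (rule A)
  have "finite A" using A fin by (auto intro: finite_subset)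
  then have "card A > 0" using A(2) by (simp add: card_gt_0_iff)
  then have pos: "card ?B > 0" using le by (metis gr0I mult_0_right not_le)
  have "card A \<le> card (verts G)" using A fin by (auto intro: card_mono)
  also have "\<dots> \<le> card (verts G) * card ?B" using pos by simp
  finally have "card A \<le> min (card (verts G)) (k - 1) * card ?B"
    using le by (simp add: min_def)
  also have "\<dots> = card (?B \<times> {..<min (card (verts G)) (k - 1)})"
    by (simp add: card_cartesian_product)
  also have "?B \<times> {..<min (card (verts G)) (k - 1)} = (\<Union>v\<in>A. slots_near k G v)"
    by (auto simp: slots_near_def)
  finally show "card A \<le> card (\<Union>v\<in>A. slots_near k G v)" .
qed

definition host :: "('a \<times> nat \<Rightarrow> 'a option) \<Rightarrow> 'a \<Rightarrow> 'a" where
  "host B v = fst (SOME s. B s = Some v)"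

lemma k_walk_of_slots:
  assumes G: "simple_graph G" and k: "k \<ge> 2" and cyc: "is_cycle G C f"
    and dom: "outer_edges G C = {}"
    and near: "\<And>s v. B s = Some v \<Longrightarrow> s \<in> slots_near k G v"
    and all: "\<And>v. v \<in> verts G - C \<Longrightarrow> \<exists>s. B s = Some v"
  shows "k_walk k G \<lparr>mverts = verts G, medges = walk_edges C f (verts G - C) (host B)\<rparr>"
proof (rule k_walk_of_cycle[OF G cyc refl])
  define slot where "slot v = (SOME s. B s = Some v)" for v
  have slot: "B (slot v) = Some v" if "v \<in> verts G - C" for v
    using someI_ex[OF all[OF that]] by (simp add: slot_def)
  have host: "host B v = fst (slot v)" for v by (simp add: host_def slot_def)
  show "host B v \<in> C \<and> adj G v (host B v)" if v: "v \<in> verts G - C" for v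
    using near[OF slot[OF v]] outside_neighbour[OF G dom v] by (auto simp: host slots_near_def)
  show "card {v \<in> verts G - C. host B v = c} \<le> k - 1" for c
  proof -
    let ?A = "{v \<in> verts G - C. host B v = c}"
    have "inj_on (\<lambda>v. snd (slot v)) ?A"
    proof (rule inj_onI)
      fix v w assume v: "v \<in> ?A" and w: "w \<in> ?A" and "snd (slot v) = snd (slot w)"
      then have "slot v = slot w" by (simp add: host prod_eq_iff)
      moreover have "B (slot v) = Some v" "B (slot w) = Some w" using v w slot by blast+
      ultimately show "v = w" by (metis option.inject)
    qed
    moreover have "(\<lambda>v. snd (slot v)) ` ?A \<subseteq> {..<k - 1}"
    proof
      fix j assume "j \<in> (\<lambda>v. snd (slot v)) ` ?A"
      then obtain v where v: "v \<in> verts G - C" "j = snd (slot v)" by blast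
      then show "j \<in> {..<k - 1}" using near[OF slot[OF v(1)]] by (auto simp: slots_near_def)
    qed
    ultimately have "card ?A \<le> card {..<k - 1}" by (intro card_inj_on_le) auto
    then show ?thesis by simp
  qed
  show "k \<ge> 1" using k by simp
qed

lemma k_walk_exists:
  assumes G: "simple_graph G" and k: "k \<ge> 2" and t: "tough (1 / (real k - 1)) G"
    and free: "two_K2_free G"
  shows "\<exists>W. k_walk k G W"
proof (cases "card (verts G) \<ge> 2")
  case True
  obtain u v where uv: "adj G u v" using has_edge[OF G k t True] by blast
  have "u \<noteq> v" using adj_verts[OF G uv] by simp
  then have "is_cycle G {u, v} ((\<lambda>_. u)(u := v))"
    by (intro edge_is_cycle[OF G uv]) auto
  then obtain C f where cyc: "is_cycle G C f" and dom: "outer_edges G C = {}"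
    using dominating_cycle_exists[OF G free] by blast
  interpret hall "verts G - C" "slots k G" "slots_near k G"
    by (rule hall_slots[OF G k t True dom])
  obtain B L where B: "fair B L" "\<forall>v \<in> verts G - C. served B v"
    using served_all_exists by blast
  have "k_walk k G \<lparr>mverts = verts G, medges = walk_edges C f (verts G - C) (host B)\<rparr>"
    using B by (intro k_walk_of_slots[OF G k cyc dom]) (auto simp: fair_def served_def)
  then show ?thesis by blast
next
  case False
  have "card (verts G) > 0" using G by (simp add: simple_graph_def card_gt_0_iff)
  then have "card (verts G) = 1" using False by simp
  then show ?thesis using k_walk_single_vertex[OF G] by blast
qed

section \<open>Programs with counting loops\<close>

text \<open>
  Programs whose only loops run a variable from \<open>0\<close> to \<open>n - 1\<close>. They denote total functions on
  states, and their running time is bounded by a polynomial whose degree is the nesting depth.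
\<close>

datatype prog =
    PSkip
  | PAssign vname aexp
  | PWrite vname aexp aexp aexp
  | PSeq prog prog
  | PIf bexp prog prog
  | PFor vname prog

fun com_of :: "prog \<Rightarrow> com" where
  "com_of PSkip = Skip"
| "com_of (PAssign x a) = Assign x a"
| "com_of (PWrite x a b c) = Write x a b c"
| "com_of (PSeq P Q) = Seq (com_of P) (com_of Q)"
| "com_of (PIf g P Q) = Cond g (com_of P) (com_of Q)"
| "com_of (PFor x P) = Seq (Assign x (Const 0))
     (Loop (Less (Var x) (Var ''n'')) (Seq (com_of P) (Assign x (Add (Var x) (Const 1)))))"

text \<open>
  The state before iteration \<open>i\<close>, except that the counter is not yet set to \<open>i\<close>. Setting it at the
  start of each iteration makes the value it had before irrelevant.
\<close>

definition iter :: "vname \<Rightarrow> (state \<Rightarrow> state) \<Rightarrow> nat \<Rightarrow> state \<Rightarrow> state" where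
  "iter x F i s = fold (\<lambda>j t. F (set_scalar x j t)) [0..<i] s"

lemma iter_0 [simp]: "iter x F 0 s = s"
  and iter_Suc [simp]: "iter x F (Suc i) s = F (set_scalar x i (iter x F i s))"
  by (simp_all add: iter_def)

fun den :: "prog \<Rightarrow> state \<Rightarrow> state" where
  "den PSkip s = s"
| "den (PAssign x a) s = set_scalar x (aval a s) s"
| "den (PWrite x a b c) s = set_arr x (aval a s) (aval b s) (aval c s) s"
| "den (PSeq P Q) s = den Q (den P s)"
| "den (PIf g P Q) s = (if bval g s then den P s else den Q s)"
| "den (PFor x P) s = set_scalar x (scalar s ''n'') (iter x (den P) (scalar s ''n'') s)"

fun assigned :: "prog \<Rightarrow> vname set" where
  "assigned PSkip = {}"
| "assigned (PAssign x a) = {x}"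
| "assigned (PWrite x a b c) = {}"
| "assigned (PSeq P Q) = assigned P \<union> assigned Q"
| "assigned (PIf g P Q) = assigned P \<union> assigned Q"
| "assigned (PFor x P) = insert x (assigned P)"

fun proper :: "prog \<Rightarrow> bool" where
  "proper (PSeq P Q) = (proper P \<and> proper Q)"
| "proper (PIf g P Q) = (proper P \<and> proper Q)"
| "proper (PFor x P) = (x \<notin> assigned P \<and> proper P)"
| "proper _ = True"

lemma scalar_set_scalar [simp]: "scalar (set_scalar x m s) = (scalar s)(x := m)"
  and arr_set_scalar [simp]: "arr (set_scalar x m s) = arr s"
  and scalar_set_arr [simp]: "scalar (set_arr x i j m s) = scalar s"
  and arr_set_arr [simp]:
    "arr (set_arr x i j m s) = (arr s)(x := (arr s x)(i := (arr s x i)(j := m)))"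
  by (simp_all add: set_scalar_def set_arr_def)

lemma iter_invariant:
  assumes "Inv 0 s"
    and "\<And>i t. i < m \<Longrightarrow> Inv i t \<Longrightarrow> Inv (Suc i) (F (set_scalar x i t))"
  shows "Inv m (iter x F m s)"
proof -
  have "i \<le> m \<Longrightarrow> Inv i (iter x F i s)" for i
    using assms by (induction i) auto
  then show ?thesis by simp
qed

lemma scalar_den:
  "y \<notin> assigned P \<Longrightarrow> scalar (den P s) y = scalar s y"
proof (induction P arbitrary: s)
  case (PFor x P)
  have "scalar (iter x (den P) m s) y = scalar s y" for m
    using PFor by (induction m) auto
  then show ?case using PFor.prems by simp
qed auto

text \<open>
  The polynomial depends on the program only. The variable \<open>n\<close> is not assigned to, so all loops
  have the same number of iterations and the bound for a loop is \<open>n\<close> times the one for its body.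
\<close>

lemma runs_com_of:
  assumes "proper P" "''n'' \<notin> assigned P"
  shows "\<exists>p :: nat poly. \<forall>s. \<exists>t. runs (com_of P) s t (den P s) \<and> t \<le> poly p (scalar s ''n'')"
  using assms
proof (induction P)
  case PSkip
  have "runs (com_of PSkip) s 1 (den PSkip s) \<and> 1 \<le> poly [:1:] (scalar s ''n'')" for s
    by (simp add: runs.Skip[simplified])
  then show ?case by blast
next
  case (PAssign x a)
  have "runs (com_of (PAssign x a)) s 1 (den (PAssign x a) s) \<and> 1 \<le> poly [:1:] (scalar s ''n'')" for s
    by (simp add: runs.Assign[simplified])
  then show ?case by blast
next
  case (PWrite x a b c)
  have "runs (com_of (PWrite x a b c)) s 1 (den (PWrite x a b c) s) \<and> 1 \<le> poly [:1:] (scalar s ''n'')" for s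
    by (simp add: runs.Write[simplified])
  then show ?case by blast
next
  case (PSeq P Q)
  obtain p :: "nat poly" where
    p: "\<And>s. \<exists>t. runs (com_of P) s t (den P s) \<and> t \<le> poly p (scalar s ''n'')"
    using PSeq by auto
  obtain q :: "nat poly" where
    q: "\<And>s. \<exists>t. runs (com_of Q) s t (den Q s) \<and> t \<le> poly q (scalar s ''n'')"
    using PSeq by auto
  have "\<exists>t. runs (com_of (PSeq P Q)) s t (den (PSeq P Q) s) \<and> t \<le> poly (p + q) (scalar s ''n'')" for s
  proof -
    obtain t where t: "runs (com_of P) s t (den P s)" "t \<le> poly p (scalar s ''n'')"
      using p by blast
    obtain u where u: "runs (com_of Q) (den P s) u (den Q (den P s))"
      "u \<le> poly q (scalar (den P s) ''n'')" using q by blast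
    have "scalar (den P s) ''n'' = scalar s ''n''" using PSeq.prems by (simp add: scalar_den)
    then show ?thesis using runs.Seq[OF t(1) u(1)] t(2) u(2)
      by (intro exI[of _ "t + u"]) simp
  qed
  then show ?case by blast
next
  case (PIf g P Q)
  obtain p :: "nat poly" where
    p: "\<And>s. \<exists>t. runs (com_of P) s t (den P s) \<and> t \<le> poly p (scalar s ''n'')"
    using PIf by auto
  obtain q :: "nat poly" where
    q: "\<And>s. \<exists>t. runs (com_of Q) s t (den Q s) \<and> t \<le> poly q (scalar s ''n'')"
    using PIf by auto
  have "\<exists>t. runs (com_of (PIf g P Q)) s t (den (PIf g P Q) s) \<and>
      t \<le> poly (1 + p + q) (scalar s ''n'')" for s
  proof (cases "bval g s")
    case True
    obtain t where t: "runs (com_of P) s t (den P s)" "t \<le> poly p (scalar s ''n'')"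
      using p by blast
    then show ?thesis
      using runs.CondTrue[OF True t(1)] True by (intro exI[of _ "1 + t"]) simp
  next
    case False
    obtain t where t: "runs (com_of Q) s t (den Q s)" "t \<le> poly q (scalar s ''n'')"
      using q by blast
    then show ?thesis
      using runs.CondFalse[OF False t(1)] False by (intro exI[of _ "1 + t"]) simp
  qed
  then show ?case by blast
next
  case (PFor x P)
  let ?test = "Less (Var x) (Var ''n'')"
  let ?body = "Seq (com_of P) (Assign x (Add (Var x) (Const 1)))"
  have x: "x \<notin> assigned P" "x \<noteq> ''n''" and n: "''n'' \<notin> assigned P" using PFor.prems by auto
  obtain p :: "nat poly" where
    p: "\<And>s. \<exists>t. runs (com_of P) s t (den P s) \<and> t \<le> poly p (scalar s ''n'')"
    using PFor n by auto
  have "\<exists>t. runs (com_of (PFor x P)) s t (den (PFor x P) s) \<and>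
      t \<le> poly ([:2:] + [:0, 1:] * (p + [:2:])) (scalar s ''n'')" for s
  proof -
    let ?n = "scalar s ''n''"
    define head where "head i = set_scalar x i (iter x (den P) i s)" for i
    have it_n: "scalar (iter x (den P) i s) ''n'' = ?n" for i
      using x n by (induction i) (auto simp: scalar_den)
    have head_n: "scalar (head i) ''n'' = ?n" and head_x: "scalar (head i) x = i" for i
      using x it_n by (auto simp: head_def)
    have head_Suc: "head (Suc i) = set_scalar x (Suc i) (den P (head i))" for i
      by (simp add: head_def)
    have loop: "\<exists>t. runs (Loop ?test ?body) (head i) t (head ?n) \<and> t \<le> 1 + (?n - i) * (poly p ?n + 2)"
      if "i \<le> ?n" for i
      using that
    proof (induction i rule: inc_induct)
      case base
      have "\<not> bval ?test (head ?n)" by (simp add: head_n head_x)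
      then show ?case using runs.LoopFalse by fastforce
    next
      case (step i)
      then obtain u where u: "runs (Loop ?test ?body) (head (Suc i)) u (head ?n)"
        "u \<le> 1 + (?n - Suc i) * (poly p ?n + 2)" by blast
      obtain t where t: "runs (com_of P) (head i) t (den P (head i))" "t \<le> poly p ?n"
        using p[of "head i"] head_n by auto
      have "scalar (den P (head i)) x = i" using x by (simp add: scalar_den head_x)
      then have "runs (Assign x (Add (Var x) (Const 1))) (den P (head i)) 1 (head (Suc i))"
        using runs.Assign[of x "Add (Var x) (Const 1)" "den P (head i)"] by (simp add: head_Suc)
      then have b: "runs ?body (head i) (t + 1) (head (Suc i))" by (rule runs.Seq[OF t(1)])
      have "bval ?test (head i)" using step by (simp add: head_n head_x)
      then have "runs (Loop ?test ?body) (head i) (1 + (t + 1) + u) (head ?n)"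
        using b u(1) by (rule runs.LoopTrue)
      moreover have "?n - i = Suc (?n - Suc i)" using step by simp
      then have "1 + (t + 1) + u \<le> 1 + (?n - i) * (poly p ?n + 2)" using t u by simp
      ultimately show ?case by blast
    qed
    obtain t where t: "runs (Loop ?test ?body) (head 0) t (head ?n)"
      "t \<le> 1 + ?n * (poly p ?n + 2)" using loop[of 0] by auto
    have "runs (Assign x (Const 0)) s 1 (head 0)"
      using runs.Assign[of x "Const 0" s] by (simp add: head_def)
    from runs.Seq[OF this t(1)] have "runs (com_of (PFor x P)) s (1 + t) (den (PFor x P) s)"
      by (simp add: head_def)
    moreover have "1 + t \<le> poly ([:2:] + [:0, 1:] * (p + [:2:])) ?n" using t(2) by simp
    ultimately show ?thesis by blast
  qed
  then show ?case by blast
qed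

section \<open>Reasoning about counting loops\<close>

type_synonym scalars = "vname \<Rightarrow> nat"
type_synonym arrays = "vname \<Rightarrow> nat \<Rightarrow> nat \<Rightarrow> nat"

text \<open>
  Independence of the variables that a loop body assigns to ensures that a condition on the enclosing
  loop counters is not affected by earlier iterations.
\<close>

definition indep :: "vname set \<Rightarrow> (scalars \<Rightarrow> arrays \<Rightarrow> bool) \<Rightarrow> bool" where
  "indep X T \<longleftrightarrow> (\<forall>\<sigma> \<sigma>' a. (\<forall>y. y \<notin> X \<longrightarrow> \<sigma> y = \<sigma>' y) \<longrightarrow> T \<sigma> a = T \<sigma>' a)"

lemma indepD: "indep X T \<Longrightarrow> (\<And>y. y \<notin> X \<Longrightarrow> \<sigma> y = \<sigma>' y) \<Longrightarrow> T \<sigma> a = T \<sigma>' a"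
  unfolding indep_def by blast

lemma indep_ex:
  assumes "indep X T"
  shows "indep (insert x X) (\<lambda>\<sigma> a. \<exists>i<m. T (\<sigma>(x := i)) a)"
  unfolding indep_def
proof (intro allI impI)
  fix \<sigma> \<sigma>' :: scalars and a
  assume eq: "\<forall>y. y \<notin> insert x X \<longrightarrow> \<sigma> y = \<sigma>' y"
  have "T (\<sigma>(x := i)) a = T (\<sigma>'(x := i)) a" for i
    using eq by (intro indepD[OF assms]) auto
  then show "(\<exists>i<m. T (\<sigma>(x := i)) a) = (\<exists>i<m. T (\<sigma>'(x := i)) a)" by simp
qed

text \<open>
  A flag that is only ever raised survives later iterations, so that a loop around \<open>P\<close> detects an
  existentially quantified condition.
\<close>

definition detects :: "nat \<Rightarrow> vname \<Rightarrow> (scalars \<Rightarrow> arrays \<Rightarrow> bool) \<Rightarrow> prog \<Rightarrow> bool" where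
  "detects N y T P \<longleftrightarrow> ''n'' \<notin> assigned P \<and> indep (assigned P) T \<and>
     (\<forall>s :: state. scalar s ''n'' = N \<longrightarrow> arr (den P s) = arr s \<and>
       scalar (den P s) y = (if T (scalar s) (arr s) then 1 else scalar s y))"

lemma detects_if:
  assumes "\<And>s :: state. bval g s = T (scalar s) (arr s)" "indep {y} T" "y \<noteq> ''n''"
  shows "detects N y T (PIf g (PAssign y (Const 1)) PSkip)"
  using assms by (auto simp: detects_def)

lemma detects_for:
  assumes P: "detects N y T P" and x: "x \<notin> assigned P" "x \<noteq> y" "x \<noteq> ''n''"
  shows "detects N y (\<lambda>\<sigma> a. \<exists>i<N. T (\<sigma>(x := i)) a) (PFor x P)"
proof -
  have n: "''n'' \<notin> assigned P" and ind: "indep (assigned P) T"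
    using P by (auto simp: detects_def)
  have "arr (den (PFor x P) s) = arr s \<and> scalar (den (PFor x P) s) y =
      (if \<exists>i<N. T ((scalar s)(x := i)) (arr s) then 1 else scalar s y)"
    if s: "scalar (s :: state) ''n'' = N" for s
  proof -
    define Inv where "Inv i t \<longleftrightarrow> (\<forall>z. z \<notin> assigned (PFor x P) \<longrightarrow> scalar t z = scalar s z) \<and>
      arr t = arr s \<and>
      scalar t y = (if \<exists>j<i. T ((scalar s)(x := j)) (arr s) then 1 else scalar s y)" for i and t :: state
    have "Inv N (iter x (den P) N s)"
    proof (rule iter_invariant)
      fix i t assume t: "Inv i t"
      let ?t = "set_scalar x i t"
      have "scalar ?t ''n'' = N" using t x n s by (auto simp: Inv_def)
      moreover have "T (scalar ?t) (arr ?t) = T ((scalar s)(x := i)) (arr s)"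
        using t by (auto simp: Inv_def intro!: indepD[OF ind])
      ultimately show "Inv (Suc i) (den P ?t)"
        using P t x by (auto simp: detects_def Inv_def scalar_den less_Suc_eq)
    qed (simp add: Inv_def)
    then show ?thesis using s x by (simp add: Inv_def)
  qed
  then show ?thesis using n x indep_ex[OF ind] by (simp add: detects_def)
qed

text \<open>
  The specification of an attempt at an improving step, with invariant \<open>J\<close> and potential \<open>\<mu>\<close>. Most
  tuples describe no such step, so an attempt may leave the arrays as they are; the trigger \<open>T\<close> tells
  when it must succeed.
\<close>

definition progress ::
    "nat \<Rightarrow> nat \<Rightarrow> (arrays \<Rightarrow> bool) \<Rightarrow> (arrays \<Rightarrow> nat) \<Rightarrow> (scalars \<Rightarrow> arrays \<Rightarrow> bool) \<Rightarrow> prog \<Rightarrow> bool" where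
  "progress N K J \<mu> T P \<longleftrightarrow> ''n'' \<notin> assigned P \<and> ''k'' \<notin> assigned P \<and> indep (assigned P) T \<and>
     (\<forall>s :: state. scalar s ''n'' = N \<and> scalar s ''k'' = K \<and> J (arr s) \<longrightarrow>
        J (arr (den P s)) \<and> (arr (den P s) = arr s \<or> \<mu> (arr (den P s)) < \<mu> (arr s)) \<and>
        (T (scalar s) (arr s) \<longrightarrow> \<mu> (arr (den P s)) < \<mu> (arr s)))"

lemma progressD:
  assumes "progress N K J \<mu> T P" "scalar s ''n'' = N" "scalar s ''k'' = K" "J (arr s)"
  shows "J (arr (den P s))" "arr (den P s) = arr s \<or> \<mu> (arr (den P s)) < \<mu> (arr s)"
    "T (scalar s) (arr s) \<Longrightarrow> \<mu> (arr (den P s)) < \<mu> (arr s)"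
  using assms by (simp_all add: progress_def)

text \<open>
  If the trigger holds at the start for some value of the counter, then either an earlier iteration
  has lowered the potential, or the arrays are unchanged when this value is reached and the trigger
  still holds.
\<close>

lemma progress_for:
  assumes P: "progress N K J \<mu> T P" and x: "x \<notin> assigned P" "x \<noteq> ''n''" "x \<noteq> ''k''"
  shows "progress N K J \<mu> (\<lambda>\<sigma> a. \<exists>i<N. T (\<sigma>(x := i)) a) (PFor x P)"
proof -
  have nk: "''n'' \<notin> assigned P" "''k'' \<notin> assigned P" and ind: "indep (assigned P) T"
    using P by (auto simp: progress_def)
  have "J (arr (den (PFor x P) s)) \<and>
      (arr (den (PFor x P) s) = arr s \<or> \<mu> (arr (den (PFor x P) s)) < \<mu> (arr s)) \<and>
      ((\<exists>i<N. T ((scalar s)(x := i)) (arr s)) \<longrightarrow> \<mu> (arr (den (PFor x P) s)) < \<mu> (arr s))"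
    if s: "scalar (s :: state) ''n'' = N" "scalar s ''k'' = K" "J (arr s)" for s
  proof -
    define Inv where "Inv i t \<longleftrightarrow> (\<forall>z. z \<notin> assigned (PFor x P) \<longrightarrow> scalar t z = scalar s z) \<and>
      J (arr t) \<and> (arr t = arr s \<or> \<mu> (arr t) < \<mu> (arr s)) \<and>
      ((\<exists>j<i. T ((scalar s)(x := j)) (arr s)) \<longrightarrow> \<mu> (arr t) < \<mu> (arr s))" for i and t :: state
    have "Inv N (iter x (den P) N s)"
    proof (rule iter_invariant)
      fix i t assume t: "Inv i t"
      let ?t = "set_scalar x i t"
      have nk_t: "scalar ?t ''n'' = N" "scalar ?t ''k'' = K" and J: "J (arr ?t)"
        using t x nk s by (auto simp: Inv_def)
      have step: "J (arr (den P ?t))"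
        "arr (den P ?t) = arr t \<or> \<mu> (arr (den P ?t)) < \<mu> (arr t)"
        "T (scalar ?t) (arr ?t) \<Longrightarrow> \<mu> (arr (den P ?t)) < \<mu> (arr t)"
        using progressD[OF P nk_t J] by simp_all
      have T: "T (scalar ?t) (arr ?t) = T ((scalar s)(x := i)) (arr s)" if "arr t = arr s"
        using t that by (auto simp: Inv_def intro!: indepD[OF ind])
      have "\<forall>z. z \<notin> assigned (PFor x P) \<longrightarrow> scalar (den P ?t) z = scalar s z"
        using t by (simp add: Inv_def scalar_den)
      moreover have "arr (den P ?t) = arr s \<or> \<mu> (arr (den P ?t)) < \<mu> (arr s)"
        using t step(2) by (auto simp: Inv_def)
      moreover have "\<mu> (arr (den P ?t)) < \<mu> (arr s)"
        if "j < Suc i" "T ((scalar s)(x := j)) (arr s)" for j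
      proof (cases "\<mu> (arr t) < \<mu> (arr s)")
        case True
        then show ?thesis using step(2) by auto
      next
        case False
        then have eq: "arr t = arr s" "\<not> j < i" using t that(2) by (auto simp: Inv_def)
        then have "j = i" using that(1) by simp
        then show ?thesis using T[OF eq(1)] step(3) that(2) eq(1) by simp
      qed
      ultimately show "Inv (Suc i) (den P ?t)" using step(1) unfolding Inv_def by blast
    qed (use s in \<open>simp add: Inv_def\<close>)
    then show ?thesis using s x by (simp add: Inv_def)
  qed
  then show ?thesis using nk x indep_ex[OF ind] by (simp add: progress_def)
qed

text \<open>
  Subtraction is truncated: the potential drops by at least \<open>d\<close>, or to zero.
\<close>

definition reduces ::
    "nat \<Rightarrow> nat \<Rightarrow> (arrays \<Rightarrow> bool) \<Rightarrow> (arrays \<Rightarrow> nat) \<Rightarrow> nat \<Rightarrow> prog \<Rightarrow> bool" where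
  "reduces N K J \<mu> d P \<longleftrightarrow> ''n'' \<notin> assigned P \<and> ''k'' \<notin> assigned P \<and>
     (\<forall>s :: state. scalar s ''n'' = N \<and> scalar s ''k'' = K \<and> J (arr s) \<longrightarrow>
        J (arr (den P s)) \<and> \<mu> (arr (den P s)) \<le> \<mu> (arr s) - d)"

lemma reducesD:
  assumes "reduces N K J \<mu> d P" "scalar s ''n'' = N" "scalar s ''k'' = K" "J (arr s)" "\<mu> (arr s) \<le> d"
  shows "scalar (den P s) ''n'' = N" "scalar (den P s) ''k'' = K"
    "J (arr (den P s))" "\<mu> (arr (den P s)) = 0"
  using assms by (fastforce simp: reduces_def scalar_den)+

lemma progress_reduces:
  assumes P: "progress N K J \<mu> T P" and T: "\<And>\<sigma> a. J a \<Longrightarrow> 0 < \<mu> a \<Longrightarrow> T \<sigma> a"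
  shows "reduces N K J \<mu> 1 P"
  unfolding reduces_def
proof (intro conjI allI impI)
  fix s :: state
  assume s: "scalar s ''n'' = N \<and> scalar s ''k'' = K \<and> J (arr s)"
  then show "J (arr (den P s))" using P by (simp add: progress_def)
  show "\<mu> (arr (den P s)) \<le> \<mu> (arr s) - 1"
  proof (cases "0 < \<mu> (arr s)")
    case True
    then have "\<mu> (arr (den P s)) < \<mu> (arr s)"
      using progressD(3)[OF P] s T by blast
    then show ?thesis by simp
  next
    case False
    have "arr (den P s) = arr s \<or> \<mu> (arr (den P s)) < \<mu> (arr s)"
      using progressD(2)[OF P] s by blast
    then show ?thesis using False by auto
  qed
qed (use P in \<open>auto simp: progress_def\<close>)

lemma reduces_for:
  assumes P: "reduces N K J \<mu> d P" and x: "x \<noteq> ''n''" "x \<noteq> ''k''"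
  shows "reduces N K J \<mu> (N * d) (PFor x P)"
  unfolding reduces_def
proof (intro conjI allI impI)
  fix s :: state
  assume s: "scalar s ''n'' = N \<and> scalar s ''k'' = K \<and> J (arr s)"
  define Inv where "Inv i t \<longleftrightarrow> scalar t ''n'' = N \<and> scalar t ''k'' = K \<and> J (arr t) \<and>
    \<mu> (arr t) \<le> \<mu> (arr s) - i * d" for i and t :: state
  have "Inv N (iter x (den P) N s)"
  proof (rule iter_invariant)
    fix i t assume t: "Inv i t"
    let ?t = "set_scalar x i t"
    have "scalar ?t ''n'' = N" "scalar ?t ''k'' = K" "J (arr ?t)"
      using t x by (simp_all add: Inv_def)
    then have "J (arr (den P ?t)) \<and> \<mu> (arr (den P ?t)) \<le> \<mu> (arr ?t) - d"
      using P unfolding reduces_def by blast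
    moreover have "scalar (den P ?t) ''n'' = N" "scalar (den P ?t) ''k'' = K"
      using P t x by (auto simp: reduces_def Inv_def scalar_den)
    ultimately show "Inv (Suc i) (den P ?t)" using t by (auto simp: Inv_def)
  qed (use s in \<open>simp add: Inv_def\<close>)
  then show "J (arr (den (PFor x P) s))"
    and "\<mu> (arr (den (PFor x P) s)) \<le> \<mu> (arr s) - N * d"
    using s x by (simp_all add: Inv_def)
qed (use P x in \<open>auto simp: reduces_def\<close>)

section \<open>The program\<close>

fun block :: "prog list \<Rightarrow> prog" where
  "block [] = PSkip"
| "block (P # Ps) = PSeq P (block Ps)"

text \<open>
  Scalar variables named by small letters, arrays by capitals. \<open>E\<close> is the adjacency matrix and \<open>W\<close> the
  output. Column \<open>0\<close> of \<open>C\<close> is the characteristic function of the cycle and column \<open>0\<close> of \<open>F\<close> the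
  successor function on it, \<open>D\<close> tells whether a first cycle has been chosen, \<open>B\<close> and \<open>L\<close>
  hold the occupants and prices of the slots.
\<close>

abbreviation Disj :: "bexp \<Rightarrow> bexp \<Rightarrow> bexp" where
  "Disj b c \<equiv> Neg (Conj (Neg b) (Neg c))"

abbreviation Edge :: "vname \<Rightarrow> vname \<Rightarrow> bexp" where
  "Edge x y \<equiv> Equal (Read ''E'' (Var x) (Var y)) (Const 1)"

abbreviation OnCycle :: "vname \<Rightarrow> bexp" where
  "OnCycle x \<equiv> Equal (Read ''C'' (Var x) (Const 0)) (Const 1)"

abbreviation Next :: "vname \<Rightarrow> aexp" where
  "Next x \<equiv> Read ''F'' (Var x) (Const 0)"

definition start_body :: prog where
  "start_body = PIf (Conj (Equal (Read ''D'' (Const 0) (Const 0)) (Const 0)) (Edge ''u'' ''v''))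
     (block
       [PWrite ''D'' (Const 0) (Const 0) (Const 1),
        PWrite ''F'' (Var ''u'') (Const 0) (Var ''v''),
        PWrite ''F'' (Var ''v'') (Const 0) (Var ''u''),
        PWrite ''C'' (Var ''u'') (Const 0) (Const 1),
        PWrite ''C'' (Var ''v'') (Const 0) (Const 1)])
     PSkip"

definition splice_prog :: prog where
  "splice_prog = block
     [PWrite ''F'' (Var ''p'') (Const 0) (Var ''q''),
      PWrite ''F'' (Var ''q'') (Const 0) (Var ''r''),
      PWrite ''F'' (Var ''r'') (Const 0) (Var ''v''),
      PWrite ''F'' (Var ''u'') (Const 0) (Var ''p''),
      PWrite ''C'' (Var ''p'') (Const 0) (Const 1),
      PWrite ''C'' (Var ''q'') (Const 0) (Const 1),
      PWrite ''C'' (Var ''r'') (Const 0) (Const 1)]"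

definition splice_guard :: bexp where
  "splice_guard = foldr Conj
     [Neg (OnCycle ''p''), Neg (OnCycle ''q''), Neg (OnCycle ''r''), Neg (OnCycle ''y''),
      Edge ''u'' ''p'', Edge ''p'' ''y'',
      Disj (Equal (Var ''p'') (Var ''q'')) (Edge ''p'' ''q''),
      Disj (Equal (Var ''q'') (Var ''r'')) (Edge ''q'' ''r''),
      Disj (Neg (Equal (Var ''p'') (Var ''r''))) (Equal (Var ''p'') (Var ''q''))]
     (OnCycle ''u'')"

definition leave_test :: prog where
  "leave_test = PFor ''z'' (PIf (Conj (Edge ''w'' ''z'') (Neg (OnCycle ''z'')))
     (PAssign ''x'' (Const 1)) PSkip)"

text \<open>
  The splice is made with \<open>v\<close> as the vertex after the inserted path. The second attempt is to let \<open>w\<close>,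
  the successor of \<open>u\<close>, leave the cycle, which needs a test that \<open>w\<close> has no neighbour outside.
\<close>

definition cycle_body :: prog where
  "cycle_body = PIf splice_guard
     (block
       [PAssign ''v'' (Next ''u''),
        PIf (Edge ''r'' ''v'') splice_prog
         (block
           [PAssign ''w'' (Var ''v''),
            PAssign ''v'' (Next ''w''),
            PAssign ''x'' (Const 0),
            leave_test,
            PIf (Conj (Equal (Var ''x'') (Const 0)) (Edge ''r'' ''v''))
              (PSeq (PWrite ''C'' (Var ''w'') (Const 0) (Const 0)) splice_prog)
              PSkip])])
     PSkip"

text \<open>
  Looks for a reason against a bid of \<open>v\<close> for slot \<open>j\<close> of \<open>c\<close>: either \<open>v\<close> already holds a slot, or a
  cheaper one is available to it. In \<open>B\<close> vertices are stored as their successors, as zero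
  stands for no occupant.
\<close>

definition bid_test :: prog where
  "bid_test = PFor ''d'' (PFor ''i''
     (PIf (Conj (Less (Var ''i'') (Sub (Var ''k'') (Const 1)))
         (Disj (Equal (Read ''B'' (Var ''d'') (Var ''i'')) (Add (Var ''v'') (Const 1)))
           (Conj (Edge ''v'' ''d'')
             (Less (Read ''L'' (Var ''d'') (Var ''i'')) (Read ''L'' (Var ''c'') (Var ''j''))))))
       (PAssign ''x'' (Const 1)) PSkip))"

definition bid_body :: prog where
  "bid_body = PIf (foldr Conj
       [Neg (OnCycle ''v''), Edge ''v'' ''c'', Less (Var ''j'') (Var ''n'')]
       (Less (Var ''j'') (Sub (Var ''k'') (Const 1))))
     (block
       [PAssign ''x'' (Const 0),
        bid_test,
        PIf (Equal (Var ''x'') (Const 0))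
          (PSeq (PWrite ''B'' (Var ''c'') (Var ''j'') (Add (Var ''v'') (Const 1)))
            (PWrite ''L'' (Var ''c'') (Var ''j'') (Add (Read ''L'' (Var ''c'') (Var ''j'')) (Const 1))))
          PSkip])
     PSkip"

definition hosted_test :: "vname \<Rightarrow> vname \<Rightarrow> prog" where
  "hosted_test a b = PFor ''j''
     (PIf (Conj (Less (Var ''j'') (Sub (Var ''k'') (Const 1)))
         (Equal (Read ''B'' (Var b) (Var ''j'')) (Add (Var a) (Const 1))))
       (PAssign ''x'' (Const 1)) PSkip)"

definition bump :: "bexp \<Rightarrow> nat \<Rightarrow> prog" where
  "bump g m = PIf g (PAssign ''t'' (Add (Var ''t'') (Const m))) PSkip"

definition output_body :: prog where
  "output_body = block
     [PAssign ''t'' (Const 0),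
      bump (Conj (OnCycle ''a'') (Equal (Next ''a'') (Var ''b''))) 1,
      bump (Conj (OnCycle ''b'') (Equal (Next ''b'') (Var ''a''))) 1,
      PAssign ''x'' (Const 0), hosted_test ''a'' ''b'', bump (Equal (Var ''x'') (Const 1)) 2,
      PAssign ''x'' (Const 0), hosted_test ''b'' ''a'', bump (Equal (Var ''x'') (Const 1)) 2,
      PWrite ''W'' (Var ''a'') (Var ''b'') (Var ''t'')]"

definition start_prog :: prog where
  "start_prog = PFor ''u'' (PFor ''v'' start_body)"

text \<open>
  The loops outside the search repeat it: the number of ordered pairs of adjacent vertices outside
  the cycle is at most \<open>n\<^sup>2\<close>, and the slack of the auction with its at most \<open>n\<^sup>2\<close> slots is at most \<open>n\<^sup>4\<close>.
\<close>

definition cycle_prog :: prog where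
  "cycle_prog = PFor ''g'' (PFor ''h'' (PFor ''u'' (PFor ''p'' (PFor ''q'' (PFor ''r''
     (PFor ''y'' cycle_body))))))"

definition bid_prog :: prog where
  "bid_prog = PFor ''e'' (PFor ''f'' (PFor ''g'' (PFor ''h'' (PFor ''v'' (PFor ''c'' (PFor ''j''
     bid_body))))))"

definition output_prog :: prog where
  "output_prog = PFor ''a'' (PFor ''b'' output_body)"

definition walk_prog :: prog where
  "walk_prog = block [start_prog, cycle_prog, bid_prog, output_prog]"

lemmas prog_defs = start_body_def splice_prog_def leave_test_def cycle_body_def bid_test_def
  bid_body_def hosted_test_def bump_def output_body_def

lemma assigned_start: "assigned start_body = {}"
  and assigned_splice: "assigned splice_prog = {}"
  and assigned_cycle: "assigned cycle_body = {''v'', ''w'', ''x'', ''z''}"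
  and assigned_bid: "assigned bid_body = {''d'', ''i'', ''x''}"
  and assigned_output: "assigned output_body = {''j'', ''t'', ''x''}"
  by (auto simp: prog_defs)

lemma walk_prog_polynomial:
  "\<exists>p :: nat poly. \<forall>s. \<exists>t. runs (com_of walk_prog) s t (den walk_prog s) \<and> t \<le> poly p (scalar s ''n'')"
proof (rule runs_com_of)
  have "proper start_body" "proper cycle_body" "proper bid_body" "proper output_body"
    by (simp_all add: prog_defs)
  then show "proper walk_prog"
    by (simp add: walk_prog_def start_prog_def cycle_prog_def bid_prog_def output_prog_def
        assigned_start assigned_cycle assigned_bid assigned_output)
  show "''n'' \<notin> assigned walk_prog"
    by (simp add: walk_prog_def start_prog_def cycle_prog_def bid_prog_def output_prog_def
        assigned_start assigned_cycle assigned_bid assigned_output)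
qed

section \<open>Finding a first edge\<close>

definition edge_matrix :: "nat graph \<Rightarrow> nat \<Rightarrow> nat \<Rightarrow> nat" where
  "edge_matrix G u v = (if adj G u v then 1 else 0)"

lemma edge_matrix_1 [simp]: "edge_matrix G u v = Suc 0 \<longleftrightarrow> adj G u v"
  by (simp add: edge_matrix_def)

definition on_cycle :: "nat \<Rightarrow> arrays \<Rightarrow> nat set" where
  "on_cycle N a = {v. v < N \<and> a ''C'' v 0 = 1}"

definition successor :: "arrays \<Rightarrow> nat \<Rightarrow> nat" where
  "successor a v = a ''F'' v 0"

text \<open>
  A single vertex is excluded, since it does not contain a cycle.
\<close>

locale tough_input =
  fixes N k :: nat and G :: "nat graph"
  assumes simple: "simple_graph G" and V: "verts G = {..<N}" and N: "2 \<le> N" and k: "2 \<le> k"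
    and tough: "tough (1 / (real k - 1)) G" and free: "two_K2_free G"
begin

lemma adj_bound: "adj G u v \<Longrightarrow> u < N" "adj G u v \<Longrightarrow> v < N"
  using adj_verts[OF simple] V by auto

definition clean :: "arrays \<Rightarrow> bool" where
  "clean a \<longleftrightarrow> a ''E'' = edge_matrix G \<and> a ''B'' = (\<lambda>_ _. 0) \<and> a ''L'' = (\<lambda>_ _. 0)"

definition started :: "arrays \<Rightarrow> bool" where
  "started a \<longleftrightarrow> clean a \<and>
     (if a ''D'' 0 0 = 0 then \<forall>v. a ''C'' v 0 = 0 else is_cycle G (on_cycle N a) (successor a))"

lemma start_progress:
  "progress N k started (\<lambda>a. 1 - a ''D'' 0 0)
     (\<lambda>\<sigma> a. a ''D'' 0 0 = 0 \<and> adj G (\<sigma> ''u'') (\<sigma> ''v'')) start_body"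
proof -
  have "started (arr (den start_body s)) \<and>
      (arr (den start_body s) = arr s \<or> 1 - arr (den start_body s) ''D'' 0 0 < 1 - arr s ''D'' 0 0) \<and>
      (arr s ''D'' 0 0 = 0 \<and> adj G (scalar s ''u'') (scalar s ''v'') \<longrightarrow>
        1 - arr (den start_body s) ''D'' 0 0 < 1 - arr s ''D'' 0 0)"
    if s: "started (arr s)" for s :: state
  proof (cases "arr s ''D'' 0 0 = 0 \<and> adj G (scalar s ''u'') (scalar s ''v'')")
    case True
    let ?u = "scalar s ''u''" and ?v = "scalar s ''v''" and ?a = "arr (den start_body s)"
    have E: "arr s ''E'' = edge_matrix G" using s by (simp add: started_def clean_def)
    have a: "?a = (arr s)
      (''D'' := (arr s ''D'')(0 := (arr s ''D'' 0)(0 := 1)),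
       ''F'' := ((arr s ''F'')(?u := (arr s ''F'' ?u)(0 := ?v)))(?v := (((arr s ''F'')(?u := (arr s ''F'' ?u)(0 := ?v))) ?v)(0 := ?u)),
       ''C'' := ((arr s ''C'')(?u := (arr s ''C'' ?u)(0 := 1)))(?v := (((arr s ''C'')(?u := (arr s ''C'' ?u)(0 := 1))) ?v)(0 := 1)))"
      using True E by (simp add: start_body_def fun_upd_twist)
    have ne: "?u \<noteq> ?v" using adj_verts[OF simple] True by blast
    have C: "on_cycle N ?a = {?u, ?v}"
      using s True adj_bound by (auto simp: on_cycle_def a started_def)
    have "successor ?a ?u = ?v" "successor ?a ?v = ?u"
      using ne by (simp_all add: successor_def a)
    then have "is_cycle G (on_cycle N ?a) (successor ?a)"
      unfolding C using True by (intro edge_is_cycle[OF simple]) auto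
    moreover have "?a ''D'' 0 0 = 1" "clean ?a"
      using s by (simp_all add: a started_def clean_def)
    ultimately show ?thesis using True by (simp add: started_def)
  next
    case False
    moreover have "arr s ''E'' = edge_matrix G" using s by (simp add: started_def clean_def)
    ultimately have "den start_body s = s" by (auto simp: start_body_def)
    then show ?thesis using False s by auto
  qed
  then show ?thesis by (simp add: progress_def assigned_start indep_def)
qed

lemma start_reduces: "reduces N k started (\<lambda>a. 1 - a ''D'' 0 0) 1 start_prog"
  unfolding start_prog_def
proof (rule progress_reduces)
  show "progress N k started (\<lambda>a. 1 - a ''D'' 0 0)
    (\<lambda>\<sigma> a. \<exists>u<N. \<exists>v<N. a ''D'' 0 0 = 0 \<and>
      adj G ((\<sigma>(''u'' := u, ''v'' := v)) ''u'') ((\<sigma>(''u'' := u, ''v'' := v)) ''v''))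
    (PFor ''u'' (PFor ''v'' start_body))"
    by (intro progress_for start_progress) (auto simp: assigned_start)
  obtain u v where "adj G u v" using has_edge[OF simple k tough] N V by auto
  then show "\<exists>u<N. \<exists>v<N. a ''D'' 0 0 = 0 \<and>
      adj G ((\<sigma>(''u'' := u, ''v'' := v)) ''u'') ((\<sigma>(''u'' := u, ''v'' := v)) ''v'')"
    if "0 < 1 - a ''D'' 0 0" for \<sigma> and a :: arrays
    using that adj_bound by (intro exI[of _ u] conjI exI[of _ v]) auto
qed

end

section \<open>Making the cycle dominating\<close>

lemma splice_prog_effect:
  shows "X \<noteq> ''F'' \<Longrightarrow> X \<noteq> ''C'' \<Longrightarrow> arr (den splice_prog s) X = arr s X"
    and "successor (arr (den splice_prog s)) =
      splice (successor (arr s)) (scalar s ''u'') (scalar s ''p'') (scalar s ''q'') (scalar s ''r'') (scalar s ''v'')"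
    and "scalar s ''p'' < N \<Longrightarrow> scalar s ''q'' < N \<Longrightarrow> scalar s ''r'' < N \<Longrightarrow>
      on_cycle N (arr (den splice_prog s)) =
      on_cycle N (arr s) \<union> {scalar s ''p'', scalar s ''q'', scalar s ''r''}"
  by (auto simp: splice_prog_def successor_def splice_def on_cycle_def fun_eq_iff)

context tough_input
begin

definition cycling :: "arrays \<Rightarrow> bool" where
  "cycling a \<longleftrightarrow> clean a \<and> is_cycle G (on_cycle N a) (successor a)"

definition outer_count :: "arrays \<Rightarrow> nat" where
  "outer_count a = card (outer_edges G (on_cycle N a))"

definition spliceable :: "nat set \<Rightarrow> (nat \<Rightarrow> nat) \<Rightarrow> nat \<Rightarrow> nat \<Rightarrow> nat \<Rightarrow> nat \<Rightarrow> nat \<Rightarrow> bool" where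
  "spliceable C f u p q r y \<longleftrightarrow> can_splice G C u p q r y \<and>
     (adj G r (f u) \<or> closed_in G C (f u) \<and> adj G r (f (f u)))"

lemma splice_guard_iff:
  assumes "arr s ''E'' = edge_matrix G"
  shows "bval splice_guard s \<longleftrightarrow> can_splice G (on_cycle N (arr s))
    (scalar s ''u'') (scalar s ''p'') (scalar s ''q'') (scalar s ''r'') (scalar s ''y'')"
proof -
  let ?u = "scalar s ''u''" and ?p = "scalar s ''p''" and ?q = "scalar s ''q''"
    and ?r = "scalar s ''r''" and ?y = "scalar s ''y''"
  define c where "c v \<longleftrightarrow> arr s ''C'' v 0 = 1" for v
  have guard: "bval splice_guard s \<longleftrightarrow> \<not> c ?p \<and> \<not> c ?q \<and> \<not> c ?r \<and> \<not> c ?y \<and>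
      adj G ?u ?p \<and> adj G ?p ?y \<and> weak_path G ?p ?q ?r \<and> c ?u"
    using assms by (auto simp: splice_guard_def weak_path_def c_def)
  have C: "v \<in> on_cycle N (arr s) \<longleftrightarrow> v < N \<and> c v" for v by (simp add: on_cycle_def c_def)
  have "?u < N \<and> ?p < N \<and> ?q < N \<and> ?r < N \<and> ?y < N"
    if "adj G ?u ?p" "adj G ?p ?y" "weak_path G ?p ?q ?r"
    using adj_bound[OF that(1)] adj_bound[OF that(2)] adj_bound(2)[of ?p ?q] adj_bound(2)[of ?q ?r] that(3)
    unfolding weak_path_def by metis
  then show ?thesis unfolding guard can_splice_def V by (auto simp: C)
qed

lemma leave_test_effect:
  assumes E: "arr s ''E'' = edge_matrix G" and n: "scalar s ''n'' = N" and x: "scalar s ''x'' = 0"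
  shows "arr (den leave_test s) = arr s"
    and "scalar (den leave_test s) ''x'' = 0 \<longleftrightarrow>
      closed_in G (on_cycle N (arr s)) (scalar s ''w'')"
proof -
  have "detects N ''x'' (\<lambda>\<sigma> a. a ''E'' (\<sigma> ''w'') (\<sigma> ''z'') = 1 \<and> a ''C'' (\<sigma> ''z'') 0 \<noteq> 1)
      (PIf (Conj (Edge ''w'' ''z'') (Neg (OnCycle ''z''))) (PAssign ''x'' (Const 1)) PSkip)"
    by (rule detects_if) (simp_all add: indep_def)
  from detects_for[OF this, of "''z''"]
  have "detects N ''x'' (\<lambda>\<sigma> a. \<exists>i<N. a ''E'' ((\<sigma>(''z'' := i)) ''w'') ((\<sigma>(''z'' := i)) ''z'') = 1 \<and>
      a ''C'' ((\<sigma>(''z'' := i)) ''z'') 0 \<noteq> 1) leave_test"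
    by (simp add: leave_test_def)
  then have d: "arr (den leave_test s) = arr s \<and> scalar (den leave_test s) ''x'' =
      (if \<exists>i<N. adj G (scalar s ''w'') i \<and> arr s ''C'' i 0 \<noteq> 1 then 1 else 0)"
    using n x E by (auto simp: detects_def)
  then show "arr (den leave_test s) = arr s" by blast
  show "scalar (den leave_test s) ''x'' = 0 \<longleftrightarrow> closed_in G (on_cycle N (arr s)) (scalar s ''w'')"
    using d by (auto simp: closed_in_def on_cycle_def V)
qed

text \<open>
  The program sees exactly the splices provided by \<open>splice_exists\<close>: it makes the first one when the
  path ends next to the successor of \<open>u\<close>, and otherwise the exchange if it is permitted.
\<close>

lemma cycle_step:
  assumes s: "scalar s ''n'' = N" "cycling (arr s)"
  shows "cycling (arr (den cycle_body s)) \<and>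
    (arr (den cycle_body s) = arr s \<or> outer_count (arr (den cycle_body s)) < outer_count (arr s)) \<and>
    (spliceable (on_cycle N (arr s)) (successor (arr s)) (scalar s ''u'') (scalar s ''p'')
       (scalar s ''q'') (scalar s ''r'') (scalar s ''y'') \<longrightarrow>
     outer_count (arr (den cycle_body s)) < outer_count (arr s))"
proof -
  let ?a = "arr s" and ?a' = "arr (den cycle_body s)"
  let ?C = "on_cycle N ?a" and ?f = "successor ?a"
  let ?u = "scalar s ''u''" and ?p = "scalar s ''p''" and ?q = "scalar s ''q''"
    and ?r = "scalar s ''r''" and ?y = "scalar s ''y''"
  have E: "?a ''E'' = edge_matrix G" and clean: "clean ?a" and cyc: "is_cycle G ?C ?f"
    using s by (simp_all add: cycling_def clean_def)
  note guard = splice_guard_iff[OF E]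
  have result: "cycling ?a' \<and> outer_count ?a' < outer_count ?a"
    if can: "can_splice G ?C ?u ?p ?q ?r ?y" and rv: "adj G ?r v"
      and D: "D = ?C \<and> v = ?f ?u \<or> D = ?C - {?f ?u} \<and> v = ?f (?f ?u) \<and> closed_in G ?C (?f ?u)"
      and a': "on_cycle N ?a' = D \<union> {?p, ?q, ?r}" "successor ?a' = splice ?f ?u ?p ?q ?r v"
        "\<And>X. X \<noteq> ''F'' \<Longrightarrow> X \<noteq> ''C'' \<Longrightarrow> ?a' X = ?a X" for D v
  proof -
    have "is_cycle G (D \<union> {?p, ?q, ?r}) (splice ?f ?u ?p ?q ?r v)"
      using can rv D by (intro is_cycle_splice[OF simple cyc]) (auto simp: can_splice_def)
    moreover have "card (outer_edges G (D \<union> {?p, ?q, ?r})) < card (outer_edges G ?C)"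
      using D by (intro outer_edges_splice[OF simple can]) auto
    ultimately show ?thesis using clean a' by (simp add: cycling_def outer_count_def clean_def)
  qed
  consider (none) "\<not> can_splice G ?C ?u ?p ?q ?r ?y"
    | (insert) "can_splice G ?C ?u ?p ?q ?r ?y" "adj G ?r (?f ?u)"
    | (replace) "can_splice G ?C ?u ?p ?q ?r ?y" "\<not> adj G ?r (?f ?u)" by blast
  then show ?thesis
  proof cases
    case none
    then have "den cycle_body s = s" using guard by (simp add: cycle_body_def)
    then show ?thesis using none s by (simp add: spliceable_def)
  next
    case insert
    let ?s = "set_scalar ''v'' (?f ?u) s"
    have den: "den cycle_body s = den splice_prog ?s"
      using insert guard E by (simp add: cycle_body_def successor_def)
    have "?p < N" "?q < N" "?r < N" using insert(1) by (auto simp: can_splice_def V)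
    then have "cycling ?a' \<and> outer_count ?a' < outer_count ?a"
      using insert splice_prog_effect(1)[of _ ?s] splice_prog_effect(2)[of ?s] splice_prog_effect(3)[of ?s N]
      by (intro result[of "?f ?u" ?C]) (simp_all add: den)
    then show ?thesis by simp
  next
    case replace
    let ?w = "?f ?u"
    let ?s1 = "set_scalar ''x'' 0 (set_scalar ''v'' (?f ?w) (set_scalar ''w'' ?w (set_scalar ''v'' ?w s)))"
    let ?s2 = "den leave_test ?s1"
    let ?ok = "closed_in G ?C ?w \<and> adj G ?r (?f ?w)"
    have "scalar ?s1 ''n'' = N" "scalar ?s1 ''x'' = 0" "arr ?s1 ''E'' = edge_matrix G"
      using s E by simp_all
    note leave = leave_test_effect[OF this(3,1,2)]
    have keep: "scalar ?s2 c = scalar ?s1 c" if "c \<noteq> ''x''" "c \<noteq> ''z''" for c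
      using that by (intro scalar_den) (simp add: leave_test_def)
    have den: "den cycle_body s =
        (if ?ok then den splice_prog (set_arr ''C'' ?w 0 0 ?s2) else ?s2)"
      using replace guard E leave keep by (simp add: cycle_body_def successor_def)
    show ?thesis
    proof (cases ?ok)
      case False
      have "den cycle_body s = ?s2" unfolding den using False by (rule if_not_P)
      then have "?a' = ?a" using leave(1) by simp
      then show ?thesis using s replace False by (simp add: spliceable_def)
    next
      case True
      let ?s3 = "set_arr ''C'' ?w 0 0 ?s2"
      have "?p < N" "?q < N" "?r < N" using replace(1) by (auto simp: can_splice_def V)
      moreover have "on_cycle N (arr ?s3) = ?C - {?w}"
        using leave(1) by (auto simp: on_cycle_def)
      moreover have "successor (arr ?s3) = ?f"
        using leave(1) by (simp add: successor_def fun_eq_iff)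
      ultimately have "cycling ?a' \<and> outer_count ?a' < outer_count ?a"
        using replace True splice_prog_effect(1)[of _ ?s3] splice_prog_effect(2)[of ?s3] splice_prog_effect(3)[of ?s3 N] leave(1)
        by (intro result[of "?f ?w" "?C - {?w}"]) (simp_all add: den keep)
      then show ?thesis by simp
    qed
  qed
qed

lemma cycle_progress:
  "progress N k cycling outer_count
     (\<lambda>\<sigma> a. spliceable (on_cycle N a) (successor a) (\<sigma> ''u'') (\<sigma> ''p'') (\<sigma> ''q'') (\<sigma> ''r'') (\<sigma> ''y''))
     cycle_body"
  unfolding progress_def
proof (intro conjI)
  show "indep (assigned cycle_body) (\<lambda>\<sigma> a. spliceable (on_cycle N a) (successor a)
      (\<sigma> ''u'') (\<sigma> ''p'') (\<sigma> ''q'') (\<sigma> ''r'') (\<sigma> ''y''))"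
    by (simp add: assigned_cycle indep_def)
qed (use cycle_step in \<open>simp_all add: assigned_cycle\<close>)

lemma cycle_reduces: "reduces N k cycling outer_count (N * N) cycle_prog"
proof -
  have "reduces N k cycling outer_count 1
     (PFor ''u'' (PFor ''p'' (PFor ''q'' (PFor ''r'' (PFor ''y'' cycle_body)))))"
  proof (rule progress_reduces)
    show "progress N k cycling outer_count (\<lambda>\<sigma> a. \<exists>u<N. \<exists>p<N. \<exists>q<N. \<exists>r<N. \<exists>y<N.
        let \<sigma>' = \<sigma>(''u'' := u, ''p'' := p, ''q'' := q, ''r'' := r, ''y'' := y) in
        spliceable (on_cycle N a) (successor a) (\<sigma>' ''u'') (\<sigma>' ''p'') (\<sigma>' ''q'') (\<sigma>' ''r'') (\<sigma>' ''y''))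
      (PFor ''u'' (PFor ''p'' (PFor ''q'' (PFor ''r'' (PFor ''y'' cycle_body)))))"
      unfolding Let_def
      by (intro progress_for cycle_progress) (auto simp: assigned_cycle)
    fix \<sigma> :: scalars and a
    assume a: "cycling a" "0 < outer_count a"
    then have "is_cycle G (on_cycle N a) (successor a)" "outer_edges G (on_cycle N a) \<noteq> {}"
      by (auto simp: cycling_def outer_count_def)
    from splice_exists[OF simple free this]
    obtain u p q r y where upqry: "spliceable (on_cycle N a) (successor a) u p q r y"
      unfolding spliceable_def by blast
    then have "u < N" "p < N" "q < N" "r < N" "y < N"
      by (auto simp: spliceable_def can_splice_def V on_cycle_def)
    then show "\<exists>u<N. \<exists>p<N. \<exists>q<N. \<exists>r<N. \<exists>y<N.
        let \<sigma>' = \<sigma>(''u'' := u, ''p'' := p, ''q'' := q, ''r'' := r, ''y'' := y) in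
        spliceable (on_cycle N a) (successor a) (\<sigma>' ''u'') (\<sigma>' ''p'') (\<sigma>' ''q'') (\<sigma>' ''r'') (\<sigma>' ''y'')"
      using upqry by simp blast
  qed
  then have "reduces N k cycling outer_count (N * (N * 1)) cycle_prog"
    unfolding cycle_prog_def by (intro reduces_for) auto
  then show ?thesis by simp
qed

lemma outer_count_le: "outer_count a \<le> N * N"
proof -
  have "outer_count a \<le> card ({..<N} \<times> {..<N})"
    unfolding outer_count_def by (intro card_mono) (auto simp: outer_edges_def V)
  then show ?thesis by (simp add: card_cartesian_product)
qed

end

section \<open>Assigning the remaining vertices\<close>

definition occupant :: "arrays \<Rightarrow> nat \<times> nat \<Rightarrow> nat option" where
  "occupant a s = (case s of (c, j) \<Rightarrow> if a ''B'' c j = 0 then None else Some (a ''B'' c j - 1))"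

definition slot_price :: "arrays \<Rightarrow> nat \<times> nat \<Rightarrow> nat" where
  "slot_price a s = (case s of (c, j) \<Rightarrow> a ''L'' c j)"

lemma occupant_Some: "occupant a (c, j) = Some v \<longleftrightarrow> a ''B'' c j = v + 1"
  by (auto simp: occupant_def)

lemma bid_test_effect:
  assumes n: "scalar s ''n'' = N" and x: "scalar s ''x'' = 0"
  shows "arr (den bid_test s) = arr s"
    and "scalar (den bid_test s) ''x'' = 0 \<longleftrightarrow>
      \<not> (\<exists>d<N. \<exists>i<N. i < scalar s ''k'' - 1 \<and> (arr s ''B'' d i = scalar s ''v'' + 1 \<or>
          arr s ''E'' (scalar s ''v'') d = 1 \<and>
          arr s ''L'' d i < arr s ''L'' (scalar s ''c'') (scalar s ''j'')))"
      (is "_ \<longleftrightarrow> \<not> ?P")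
proof -
  let ?T = "\<lambda>\<sigma> a. \<sigma> ''i'' < \<sigma> ''k'' - 1 \<and> (a ''B'' (\<sigma> ''d'') (\<sigma> ''i'') = \<sigma> ''v'' + 1 \<or>
      a ''E'' (\<sigma> ''v'') (\<sigma> ''d'') = 1 \<and>
      a ''L'' (\<sigma> ''d'') (\<sigma> ''i'') < a ''L'' (\<sigma> ''c'') (\<sigma> ''j''))"
  have "detects N ''x'' (\<lambda>\<sigma> a. \<exists>d<N. \<exists>i<N. ?T (\<sigma>(''d'' := d, ''i'' := i)) a) bid_test"
    unfolding bid_test_def
    by (intro detects_for detects_if) (auto simp: indep_def)
  moreover have "(\<exists>d<N. \<exists>i<N. ?T ((scalar s)(''d'' := d, ''i'' := i)) (arr s)) \<longleftrightarrow> ?P"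
    by (intro ex_cong1 conj_cong refl) simp_all
  ultimately have d: "arr (den bid_test s) = arr s"
      "scalar (den bid_test s) ''x'' = (if ?P then 1 else 0)"
    using n x unfolding detects_def by presburger+
  then show "arr (den bid_test s) = arr s" by blast
  show "scalar (den bid_test s) ''x'' = 0 \<longleftrightarrow> \<not> ?P"
    unfolding d(2) by (rule if_split[THEN iffD2]) simp
qed

text \<open>
  The arrays \<open>C\<close> and \<open>F\<close> do not change any more once the cycle dominates the graph; \<open>a0\<close> are the
  arrays at that moment.
\<close>

locale tough_input_cycle = tough_input +
  fixes a0 :: arrays
  assumes cycling: "cycling a0" and dominating: "outer_count a0 = 0"
begin

definition C where "C = on_cycle N a0"

lemma cycle: "is_cycle G C (successor a0)"
  using cycling by (simp add: cycling_def C_def)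

lemma C_iff: "c < N \<Longrightarrow> c \<in> C \<longleftrightarrow> a0 ''C'' c 0 = 1"
  by (simp add: C_def on_cycle_def)

lemma no_outer_edges: "outer_edges G C = {}"
  using dominating finite_outer_edges[OF simple] by (simp add: outer_count_def C_def)

sublocale hall "verts G - C" "slots k G" "slots_near k G"
  using N V by (intro hall_slots[OF simple k tough _ no_outer_edges]) simp

lemma near_iff: "(c, j) \<in> slots_near k G v \<longleftrightarrow> adj G v c \<and> j < N \<and> j < k - 1"
  by (auto simp: slots_near_def V)

definition bidding :: "arrays \<Rightarrow> bool" where
  "bidding a \<longleftrightarrow> a ''E'' = edge_matrix G \<and> a ''C'' = a0 ''C'' \<and> a ''F'' = a0 ''F'' \<and>
     fair (occupant a) (slot_price a)"

definition bid_slack :: "arrays \<Rightarrow> nat" where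
  "bid_slack a = slack (occupant a) (slot_price a)"

definition may_bid :: "arrays \<Rightarrow> nat \<Rightarrow> nat \<times> nat \<Rightarrow> bool" where
  "may_bid a v s \<longleftrightarrow> v \<in> verts G - C \<and> \<not> served (occupant a) v \<and> cheapest (slot_price a) v s"

lemma fair_near: "fair B L \<Longrightarrow> B s = Some v \<Longrightarrow> v \<in> verts G - C \<and> s \<in> slots_near k G v"
  unfolding fair_def by blast

lemma bid_step:
  assumes s: "scalar s ''n'' = N" "scalar s ''k'' = k" "bidding (arr s)"
  shows "bidding (arr (den bid_body s)) \<and>
    (arr (den bid_body s) = arr s \<or> bid_slack (arr (den bid_body s)) < bid_slack (arr s)) \<and>
    (may_bid (arr s) (scalar s ''v'') (scalar s ''c'', scalar s ''j'') \<longrightarrow>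
      bid_slack (arr (den bid_body s)) < bid_slack (arr s))"
proof -
  let ?a = "arr s" and ?a' = "arr (den bid_body s)"
  let ?v = "scalar s ''v''" and ?c = "scalar s ''c''" and ?j = "scalar s ''j''"
  have E: "?a ''E'' = edge_matrix G" and aC: "?a ''C'' = a0 ''C''"
    and fair: "fair (occupant ?a) (slot_price ?a)"
    using s by (simp_all add: bidding_def)
  define g where "g \<longleftrightarrow> ?v \<in> verts G - C \<and> (?c, ?j) \<in> slots_near k G ?v"
  have "g \<longleftrightarrow> a0 ''C'' ?v 0 \<noteq> 1 \<and> adj G ?v ?c \<and> ?j < N \<and> ?j < k - 1"
    unfolding g_def near_iff V using C_iff[of ?v] adj_bound(1)[of ?v ?c] by auto
  then have den: "den bid_body s = (if g then
      let t = den bid_test (set_scalar ''x'' 0 s) in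
      if scalar t ''x'' = 0 then
        set_arr ''L'' (scalar t ''c'') (scalar t ''j'') (arr t ''L'' (scalar t ''c'') (scalar t ''j'') + 1)
          (set_arr ''B'' (scalar t ''c'') (scalar t ''j'') (scalar t ''v'' + 1) t)
      else t else s)"
    using s E aC by (simp add: bid_body_def Let_def)
  show ?thesis
  proof (cases g)
    case False
    then have "den bid_body s = s" using den by (simp only: if_False)
    moreover have "\<not> may_bid ?a ?v (?c, ?j)"
      using False unfolding may_bid_def cheapest_def g_def by blast
    ultimately show ?thesis using s by simp
  next
    case True
    let ?s = "set_scalar ''x'' 0 s"
    let ?t = "den bid_test ?s"
    have n: "scalar ?s ''n'' = N" "scalar ?s ''x'' = 0" using s by simp_all
    have keep: "scalar ?t y = scalar s y" if "y \<noteq> ''x''" "y \<noteq> ''d''" "y \<noteq> ''i''" for y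
      using that scalar_den[of y bid_test ?s] by (simp add: bid_test_def)
    have arr_t: "arr ?t = ?a" using bid_test_effect(1)[OF n] by simp
    have test: "scalar ?t ''x'' = 0 \<longleftrightarrow> may_bid ?a ?v (?c, ?j)"
    proof -
      have "served (occupant ?a) ?v \<longleftrightarrow> (\<exists>d<N. \<exists>i<N. i < k - 1 \<and> ?a ''B'' d i = ?v + 1)"
      proof
        assume "served (occupant ?a) ?v"
        then obtain d i where di: "occupant ?a (d, i) = Some ?v" by (auto simp: served_def)
        then have "(d, i) \<in> slots_near k G ?v" using fair_near[OF fair] by blast
        then show "\<exists>d<N. \<exists>i<N. i < k - 1 \<and> ?a ''B'' d i = ?v + 1"
          using di adj_bound(2) unfolding near_iff occupant_Some by blast
      next
        assume "\<exists>d<N. \<exists>i<N. i < k - 1 \<and> ?a ''B'' d i = ?v + 1"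
        then show "served (occupant ?a) ?v" unfolding served_def occupant_Some[symmetric] by blast
      qed
      moreover have "cheapest (slot_price ?a) ?v (?c, ?j) \<longleftrightarrow>
          \<not> (\<exists>d<N. \<exists>i<N. i < k - 1 \<and> adj G ?v d \<and> ?a ''L'' d i < ?a ''L'' ?c ?j)"
      proof -
        have "cheapest (slot_price ?a) ?v (?c, ?j) \<longleftrightarrow>
            (\<forall>d i. adj G ?v d \<and> i < N \<and> i < k - 1 \<longrightarrow> ?a ''L'' ?c ?j \<le> ?a ''L'' d i)"
          using True unfolding cheapest_def Ball_def split_paired_All near_iff g_def slot_price_def
          by simp
        then show ?thesis using adj_bound(2)[of ?v] by (meson not_less)
      qed
      ultimately show ?thesis
        using True bid_test_effect(2)[OF n] s E unfolding may_bid_def g_def by auto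
    qed
    show ?thesis
    proof (cases "may_bid ?a ?v (?c, ?j)")
      case False
      then have "den bid_body s = ?t" using den True test by (simp add: Let_def)
      then show ?thesis using False s arr_t by simp
    next
      case may: True
      then have d: "den bid_body s = set_arr ''L'' ?c ?j (?a ''L'' ?c ?j + 1) (set_arr ''B'' ?c ?j (?v + 1) ?t)"
        using den True test arr_t by (simp add: Let_def keep)
      have o: "occupant ?a' = (occupant ?a)((?c, ?j) := Some ?v)"
        by (auto simp: fun_eq_iff d arr_t occupant_def)
      have p: "slot_price ?a' = (slot_price ?a)((?c, ?j) := slot_price ?a (?c, ?j) + 1)"
        by (auto simp: fun_eq_iff d arr_t slot_price_def)
      have v: "?v \<in> verts G - C" "\<not> served (occupant ?a) ?v" "cheapest (slot_price ?a) ?v (?c, ?j)"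
        using may by (auto simp: may_bid_def)
      have "fair (occupant ?a') (slot_price ?a')"
        unfolding o p by (rule fair_bid[OF fair v])
      then have "bidding ?a'" using s by (simp add: bidding_def d arr_t)
      moreover have "bid_slack ?a' < bid_slack ?a"
        unfolding bid_slack_def o p by (rule slack_bid[OF fair v])
      ultimately show ?thesis by simp
    qed
  qed
qed

lemma bid_progress:
  "progress N k bidding bid_slack (\<lambda>\<sigma> a. may_bid a (\<sigma> ''v'') (\<sigma> ''c'', \<sigma> ''j'')) bid_body"
  unfolding progress_def
proof (intro conjI)
  show "indep (assigned bid_body) (\<lambda>\<sigma> a. may_bid a (\<sigma> ''v'') (\<sigma> ''c'', \<sigma> ''j''))"
    by (simp add: assigned_bid indep_def)
qed (use bid_step in \<open>simp_all add: assigned_bid\<close>)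

lemma bid_reduces: "reduces N k bidding bid_slack (N * (N * (N * N))) bid_prog"
proof -
  have "reduces N k bidding bid_slack 1 (PFor ''v'' (PFor ''c'' (PFor ''j'' bid_body)))"
  proof (rule progress_reduces)
    show "progress N k bidding bid_slack (\<lambda>\<sigma> a. \<exists>v<N. \<exists>c<N. \<exists>j<N.
        let \<sigma>' = \<sigma>(''v'' := v, ''c'' := c, ''j'' := j) in may_bid a (\<sigma>' ''v'') (\<sigma>' ''c'', \<sigma>' ''j''))
      (PFor ''v'' (PFor ''c'' (PFor ''j'' bid_body)))"
      unfolding Let_def
      by (intro progress_for bid_progress) (auto simp: assigned_bid)
    fix \<sigma> :: scalars and a
    assume a: "bidding a" "0 < bid_slack a"
    have "\<not> (\<forall>v \<in> verts G - C. served (occupant a) v)"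
    proof
      assume "\<forall>v \<in> verts G - C. served (occupant a) v"
      then have "bid_slack a = 0" unfolding bid_slack_def slack_def by (rule if_P)
      then show False using a(2) by simp
    qed
    then obtain v where v: "v \<in> verts G - C" "\<not> served (occupant a) v" by blast
    from cheapest_exists[OF v(1)] obtain s where "cheapest (slot_price a) v s" ..
    then obtain c j where cj: "cheapest (slot_price a) v (c, j)" by (cases s) simp
    then have "adj G v c" "j < N" by (simp_all add: cheapest_def near_iff)
    moreover have "c < N" using adj_bound(2)[OF \<open>adj G v c\<close>] .
    moreover have "v < N" using v V by simp
    moreover have "may_bid a v (c, j)" using v cj by (simp add: may_bid_def)
    ultimately show "\<exists>v<N. \<exists>c<N. \<exists>j<N.
        let \<sigma>' = \<sigma>(''v'' := v, ''c'' := c, ''j'' := j) in may_bid a (\<sigma>' ''v'') (\<sigma>' ''c'', \<sigma>' ''j'')"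
      by simp blast
  qed
  then have "reduces N k bidding bid_slack (N * (N * (N * (N * 1)))) bid_prog"
    unfolding bid_prog_def by (intro reduces_for) auto
  then show ?thesis by simp
qed

lemma bid_slack_le: "bid_slack a \<le> N * (N * (N * N))"
proof -
  have "card (slots k G) \<le> N * N" by (simp add: slots_def V card_cartesian_product)
  then have "card (slots k G) * card (slots k G) \<le> (N * N) * (N * N)" by (intro mult_le_mono)
  then show ?thesis
    unfolding bid_slack_def using slack_le[of "occupant a" "slot_price a"]
    by (simp add: mult.assoc)
qed

text \<open>
  The choice in \<open>host\<close> is unique because every vertex occupies at most one slot, so the
  program can read the host of a vertex from the table of occupants.
\<close>

lemma hosted_iff:
  assumes fair: "fair (occupant a) (slot_price a)" and served: "\<forall>v \<in> verts G - C. served (occupant a) v"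
  shows "(\<exists>j<N. j < k - 1 \<and> a ''B'' y j = x + 1) \<longleftrightarrow> x \<in> verts G - C \<and> host (occupant a) x = y"
proof
  assume "\<exists>j<N. j < k - 1 \<and> a ''B'' y j = x + 1"
  then obtain j where j: "occupant a (y, j) = Some x" using occupant_Some by blast
  have "s = (y, j)" if "occupant a s = Some x" for s
    using fair j that unfolding fair_def by blast
  then have "(SOME s. occupant a s = Some x) = (y, j)" using j by (rule some_equality[rotated])
  then show "x \<in> verts G - C \<and> host (occupant a) x = y"
    using fair_near[OF fair j] by (simp add: host_def)
next
  assume x: "x \<in> verts G - C \<and> host (occupant a) x = y"
  define s where "s = (SOME s. occupant a s = Some x)"
  have s: "occupant a s = Some x"
    using served x someI_ex[of "\<lambda>s. occupant a s = Some x"] by (auto simp: served_def s_def)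
  have "s = (y, snd s)" using x by (simp add: host_def s_def prod_eq_iff)
  then obtain j where "occupant a (y, j) = Some x" using s by metis
  then show "\<exists>j<N. j < k - 1 \<and> a ''B'' y j = x + 1"
    using fair_near[OF fair] unfolding near_iff[of y] occupant_Some near_iff by (metis near_iff occupant_Some)
qed

end

section \<open>Writing the output\<close>

lemma card_edge_preimage:
  assumes "x \<noteq> y"
  shows "card {c \<in> A. {c, g c} = {x, y}} = of_bool (x \<in> A \<and> g x = y) + of_bool (y \<in> A \<and> g y = x)"
proof -
  have "{c \<in> A. {c, g c} = {x, y}} =
      (if x \<in> A \<and> g x = y then {x} else {}) \<union> (if y \<in> A \<and> g y = x then {y} else {})"
    by (auto simp: doubleton_eq_iff)
  then show ?thesis using assms by simp
qed

lemma count_walk_edges: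
  assumes "finite C" "finite I" "x \<noteq> y"
  shows "count (walk_edges C f I m) {x, y} =
    of_bool (x \<in> C \<and> f x = y) + of_bool (y \<in> C \<and> f y = x) +
    2 * (of_bool (x \<in> I \<and> m x = y) + of_bool (y \<in> I \<and> m y = x))"
  using assms by (simp add: walk_edges_def count_image_mset_set card_edge_preimage)

lemma output_multigraph_eqI:
  assumes edges: "\<And>e. e \<in># M \<Longrightarrow> \<exists>x y. x < y \<and> y < n \<and> e = {x, y}"
    and entry: "\<And>x y. x < y \<Longrightarrow> y < n \<Longrightarrow> arr s ''W'' x y = count M {x, y}"
  shows "output_multigraph n s = \<lparr>mverts = {..<n}, medges = M\<rparr>"
proof -
  let ?N = "\<Sum>v<n. \<Sum>u<v. replicate_mset (arr s ''W'' u v) {u, v}"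
  have cN: "count ?N e = (\<Sum>v<n. \<Sum>u<v. if {u, v} = e then arr s ''W'' u v else 0)" for e
    unfolding count_sum by (intro sum.cong refl) simp
  have "?N = M"
  proof (rule multiset_eqI)
    fix e
    show "count ?N e = count M e"
    proof (cases "\<exists>x y. x < y \<and> y < n \<and> e = {x, y}")
      case True
      then obtain x y where xy: "x < y" "y < n" "e = {x, y}" by blast
      have "count ?N e = (\<Sum>v<n. \<Sum>u<v. if v = y \<and> u = x then arr s ''W'' x y else 0)"
        unfolding cN using xy by (intro sum.cong refl) (auto simp: doubleton_eq_iff)
      also have "\<dots> = (\<Sum>v<n. if v = y then arr s ''W'' x y else 0)"
      proof (rule sum.cong[OF refl])
        fix v
        show "(\<Sum>u<v. if v = y \<and> u = x then arr s ''W'' x y else 0)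
            = (if v = y then arr s ''W'' x y else 0)"
          using xy by (cases "v = y") auto
      qed
      also have "\<dots> = arr s ''W'' x y" using xy by simp
      finally show ?thesis using entry xy by simp
    next
      case False
      have "count ?N e = 0" unfolding cN using False by (intro sum.neutral ballI) auto
      moreover have "count M e = 0" using False edges by (meson not_in_iff)
      ultimately show ?thesis by simp
    qed
  qed
  then show ?thesis by (simp add: output_multigraph_def)
qed

text \<open>
  The multiplicity of the edge \<open>xy\<close> in the walk. On a cycle of length two both of the first summands
  are one.
\<close>

definition entry :: "nat \<Rightarrow> nat \<Rightarrow> arrays \<Rightarrow> nat \<Rightarrow> nat \<Rightarrow> nat" where
  "entry N k a x y =
     of_bool (a ''C'' x 0 = 1 \<and> a ''F'' x 0 = y) + of_bool (a ''C'' y 0 = 1 \<and> a ''F'' y 0 = x) +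
     2 * (of_bool (\<exists>j<N. j < k - 1 \<and> a ''B'' y j = x + 1) +
          of_bool (\<exists>j<N. j < k - 1 \<and> a ''B'' x j = y + 1))"

lemma entry_cong:
  "(\<And>X. X \<noteq> ''W'' \<Longrightarrow> a X = a' X) \<Longrightarrow> entry N k a = entry N k a'"
  by (intro ext) (simp add: entry_def)

lemma hosted_test_effect:
  assumes s: "scalar s ''n'' = N" "scalar s ''x'' = 0"
    and v: "v \<noteq> ''j''" "v \<noteq> ''x''" "w \<noteq> ''j''" "w \<noteq> ''x''"
  shows "arr (den (hosted_test v w) s) = arr s"
    and "scalar (den (hosted_test v w) s) ''x'' =
      of_bool (\<exists>j<N. j < scalar s ''k'' - 1 \<and> arr s ''B'' (scalar s w) j = scalar s v + 1)"
proof -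
  let ?T = "\<lambda>\<sigma> a. \<sigma> ''j'' < \<sigma> ''k'' - 1 \<and> a ''B'' (\<sigma> w) (\<sigma> ''j'') = \<sigma> v + 1"
  let ?P = "\<exists>j<N. j < scalar s ''k'' - 1 \<and> arr s ''B'' (scalar s w) j = scalar s v + 1"
  have "detects N ''x'' (\<lambda>\<sigma> a. \<exists>j<N. ?T (\<sigma>(''j'' := j)) a) (hosted_test v w)"
    unfolding hosted_test_def using v
    by (intro detects_for detects_if) (auto simp: indep_def)
  moreover have "(\<exists>j<N. ?T ((scalar s)(''j'' := j)) (arr s)) \<longleftrightarrow> ?P"
    by (intro ex_cong1 conj_cong refl) (use v in simp_all)
  ultimately have d: "arr (den (hosted_test v w) s) = arr s"
      "scalar (den (hosted_test v w) s) ''x'' = (if ?P then 1 else 0)"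
    using s unfolding detects_def by presburger+
  show "arr (den (hosted_test v w) s) = arr s" by (rule d)
  show "scalar (den (hosted_test v w) s) ''x'' = of_bool ?P" unfolding d(2) of_bool_def ..
qed

lemma bump_effect:
  "arr (den (bump g m) s) = arr s"
  "scalar (den (bump g m) s) = (scalar s)(''t'' := scalar s ''t'' + m * of_bool (bval g s))"
  by (simp_all add: bump_def)

lemma output_body_effect:
  assumes s: "scalar s ''n'' = N" "scalar s ''k'' = k"
  shows "arr (den output_body s) = (arr s)(''W'' := (arr s ''W'')(scalar s ''a'' :=
    (arr s ''W'' (scalar s ''a''))(scalar s ''b'' := entry N k (arr s) (scalar s ''a'') (scalar s ''b''))))"
proof -
  let ?x = "scalar s ''a''" and ?y = "scalar s ''b''"
  let ?h = "\<lambda>x y. \<exists>j<N. j < k - 1 \<and> arr s ''B'' y j = x + 1"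
  have keep: "scalar (den (hosted_test v w) t) c = scalar t c" if "c \<noteq> ''x''" "c \<noteq> ''j''" for v w c t
    using that scalar_den[of c "hosted_test v w" t] by (simp add: hosted_test_def)
  let ?g1 = "Conj (OnCycle ''a'') (Equal (Next ''a'') (Var ''b''))"
  let ?g2 = "Conj (OnCycle ''b'') (Equal (Next ''b'') (Var ''a''))"
  let ?g3 = "Equal (Var ''x'') (Const 1)"
  define s1 where "s1 = den (bump ?g2 1) (den (bump ?g1 1) (set_scalar ''t'' 0 s))"
  define s2 where "s2 = den (hosted_test ''a'' ''b'') (set_scalar ''x'' 0 s1)"
  define s3 where "s3 = den (bump ?g3 2) s2"
  define s4 where "s4 = den (hosted_test ''b'' ''a'') (set_scalar ''x'' 0 s3)"
  define s5 where "s5 = den (bump ?g3 2) s4"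
  define m where "m = (of_bool (arr s ''C'' ?x 0 = 1 \<and> arr s ''F'' ?x 0 = ?y) +
     of_bool (arr s ''C'' ?y 0 = 1 \<and> arr s ''F'' ?y 0 = ?x) :: nat)"
  have s1: "arr s1 = arr s" "scalar s1 = (scalar s)(''t'' := m)"
    by (simp_all add: s1_def m_def bump_effect)
  have s2: "arr s2 = arr s" "scalar s2 ''x'' = of_bool (?h ?x ?y)" "scalar s2 ''t'' = m"
    "scalar s2 ''a'' = ?x" "scalar s2 ''b'' = ?y" "scalar s2 ''n'' = N" "scalar s2 ''k'' = k"
    using hosted_test_effect[of "set_scalar ''x'' 0 s1" N "''a''" "''b''"] s s1
    by (simp_all add: s2_def keep)
  have s3: "arr s3 = arr s" "scalar s3 ''t'' = m + 2 * of_bool (?h ?x ?y)"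
    "scalar s3 ''a'' = ?x" "scalar s3 ''b'' = ?y" "scalar s3 ''n'' = N" "scalar s3 ''k'' = k"
    using s2 by (simp_all add: s3_def bump_effect)
  have s4: "arr s4 = arr s" "scalar s4 ''x'' = of_bool (?h ?y ?x)"
    "scalar s4 ''t'' = m + 2 * of_bool (?h ?x ?y)" "scalar s4 ''a'' = ?x" "scalar s4 ''b'' = ?y"
    using hosted_test_effect[of "set_scalar ''x'' 0 s3" N "''b''" "''a''"] s3
    by (simp_all add: s4_def keep)
  have s5: "arr s5 = arr s" "scalar s5 ''t'' = entry N k (arr s) ?x ?y"
    "scalar s5 ''a'' = ?x" "scalar s5 ''b'' = ?y"
    using s4 by (simp_all add: s5_def bump_effect entry_def m_def)
  have "den output_body s = set_arr ''W'' (scalar s5 ''a'') (scalar s5 ''b'') (scalar s5 ''t'') s5"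
    by (simp add: output_body_def s1_def s2_def s3_def s4_def s5_def)
  then show ?thesis using s5 by simp
qed

lemma output_prog_effect:
  assumes s: "scalar s ''n'' = N" "scalar s ''k'' = k" and xy: "x < N" "y < N"
  shows "arr (den output_prog s) ''W'' x y = entry N k (arr s) x y"
proof -
  define same where "same t \<longleftrightarrow> scalar t ''n'' = N \<and> scalar t ''k'' = k \<and>
    (\<forall>X. X \<noteq> ''W'' \<longrightarrow> arr t X = arr s X)" for t :: state
  define Row where "Row i t \<longleftrightarrow> same t \<and>
    (\<forall>a<i. \<forall>b<N. arr t ''W'' a b = entry N k (arr s) a b)" for i and t :: state
  define Cell where "Cell i j t \<longleftrightarrow> Row i t \<and> scalar t ''a'' = i \<and>
    (\<forall>b<j. arr t ''W'' i b = entry N k (arr s) i b)" for i j and t :: state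
  have "Row N (iter ''a'' (den (PFor ''b'' output_body)) N s)"
  proof (rule iter_invariant)
    fix i t assume row: "Row i t"
    let ?t = "set_scalar ''a'' i t"
    have "Cell i N (iter ''b'' (den output_body) N ?t)"
    proof (rule iter_invariant)
      show "Cell i 0 ?t" using row by (simp add: Cell_def Row_def same_def)
    next
      fix j t assume cell: "Cell i j t"
      let ?u = "set_scalar ''b'' j t"
      have nk: "scalar ?u ''n'' = N" "scalar ?u ''k'' = k" and a: "scalar ?u ''a'' = i"
        using cell by (simp_all add: Cell_def Row_def same_def)
      have e: "entry N k (arr ?u) = entry N k (arr s)"
        using cell by (intro entry_cong) (simp add: Cell_def Row_def same_def)
      have arr: "arr (den output_body ?u) = (arr t)(''W'' := (arr t ''W'')(i :=
          (arr t ''W'' i)(j := entry N k (arr s) i j)))"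
        using output_body_effect[OF nk] a e by simp
      have "scalar (den output_body ?u) c = scalar ?u c" if "c \<in> {''n'', ''k'', ''a''}" for c
        using that by (intro scalar_den) (auto simp: assigned_output)
      then have "same (den output_body ?u)" "scalar (den output_body ?u) ''a'' = i"
        using cell by (simp_all add: arr Cell_def Row_def same_def)
      then show "Cell i (Suc j) (den output_body ?u)"
        using cell by (auto simp: Cell_def Row_def arr less_Suc_eq)
    qed
    moreover have "scalar ?t ''n'' = N" using row by (simp add: Row_def same_def)
    ultimately show "Row (Suc i) (den (PFor ''b'' output_body) ?t)"
      by (auto simp: Cell_def Row_def same_def less_Suc_eq)
  qed (use s in \<open>simp add: Row_def same_def\<close>)
  then show ?thesis using s xy by (simp add: output_prog_def Row_def)
qed

context tough_input_cycle
begin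

lemma output_is_k_walk:
  assumes a: "bidding a" "bid_slack a = 0"
    and W: "\<And>x y. x < N \<Longrightarrow> y < N \<Longrightarrow> arr s ''W'' x y = entry N k a x y"
  shows "k_walk k G (output_multigraph N s)"
proof -
  let ?B = "occupant a"
  let ?M = "walk_edges C (successor a0) (verts G - C) (host ?B)"
  have fair: "fair ?B (slot_price a)" and aC: "a ''C'' = a0 ''C''" and aF: "a ''F'' = a0 ''F''"
    using a by (simp_all add: bidding_def)
  have served: "\<forall>v \<in> verts G - C. served ?B v"
    using slack_0D[OF fair] a(2) by (simp add: bid_slack_def)
  have walk: "k_walk k G \<lparr>mverts = verts G, medges = ?M\<rparr>"
    using fair_near[OF fair] served
    by (intro k_walk_of_slots[OF simple k cycle no_outer_edges]) (auto simp: served_def)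
  have "output_multigraph N s = \<lparr>mverts = {..<N}, medges = ?M\<rparr>"
  proof (rule output_multigraph_eqI)
    fix e assume "e \<in># ?M"
    then have "e \<in># repeat_mset (2 * k) (mset_set (edges G))"
      using walk by (auto simp: k_walk_def spanning_subgraph_def times_graph_def dest: mset_subset_eqD)
    then have "e \<in> edges G" by (metis count_mset_set(3) count_repeat_mset mult_0_right not_in_iff)
    then have "e \<subseteq> {..<N}" "card e = 2" using simple V by (auto simp: simple_graph_def)
    then show "\<exists>x y. x < y \<and> y < N \<and> e = {x, y}"
      by (auto simp: card_2_iff) (metis insert_commute linorder_neqE_nat)
  next
    fix x y assume xy: "x < y" "y < N"
    have fin: "finite C" "finite (verts G - C)"
      using cycle V by (auto simp: is_cycle_def intro: finite_subset)
    have "count ?M {x, y} = entry N k a x y"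
      using xy C_iff[of x] C_iff[of y]
      by (simp only: entry_def hosted_iff[OF fair served] count_walk_edges[OF fin less_imp_neq[OF xy(1)]])
        (simp add: aC aF successor_def)
    then show "arr s ''W'' x y = count ?M {x, y}" using W xy by simp
  qed
  then show ?thesis using walk V by simp
qed

end

context tough_input
begin

lemma walk_prog_correct:
  "k_walk k G (output_multigraph N (den walk_prog (input_state k G)))"
proof -
  let ?s0 = "input_state k G"
  let ?s1 = "den start_prog ?s0"
  let ?s2 = "den cycle_prog ?s1"
  let ?s3 = "den bid_prog ?s2"
  have "started (arr ?s0)"
    by (auto simp: input_state_def started_def clean_def edge_matrix_def adj_def fun_eq_iff)
  then have s1: "scalar ?s1 ''n'' = N" "scalar ?s1 ''k'' = k" "started (arr ?s1)"
      "1 - arr ?s1 ''D'' 0 0 = 0"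
    using reducesD[OF start_reduces, of ?s0] V by (simp_all add: input_state_def)
  then have "cycling (arr ?s1)" by (auto simp: started_def cycling_def split: if_splits)
  then have s2: "scalar ?s2 ''n'' = N" "scalar ?s2 ''k'' = k" "cycling (arr ?s2)" "outer_count (arr ?s2) = 0"
    using reducesD[OF cycle_reduces s1(1,2)] outer_count_le by simp_all
  interpret tough_input_cycle N k G "arr ?s2"
    by unfold_locales (rule s2)+
  have "occupant (arr ?s2) = (\<lambda>_. None)" "slot_price (arr ?s2) = (\<lambda>_. 0)"
    using s2(3) by (auto simp: cycling_def clean_def occupant_def slot_price_def)
  then have "bidding (arr ?s2)"
    using s2(3) fair_init by (simp add: bidding_def cycling_def clean_def)
  then have s3: "scalar ?s3 ''n'' = N" "scalar ?s3 ''k'' = k" "bidding (arr ?s3)" "bid_slack (arr ?s3) = 0"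
    using reducesD[OF bid_reduces s2(1,2)] bid_slack_le by simp_all
  have "den walk_prog ?s0 = den output_prog ?s3" by (simp add: walk_prog_def)
  then show ?thesis
    using output_is_k_walk[OF s3(3,4)] output_prog_effect[OF s3(1,2)] by simp
qed

end

text \<open>
  For a single vertex the program runs as well, but its result does not matter: no entry of \<open>W\<close> is
  read, and the walk without edges is what is wanted.
\<close>

lemma walk_prog_output:
  assumes k: "k \<ge> 2" and G: "simple_graph G" and V: "verts G = {..<card (verts G)}"
    and t: "tough (1 / (real k - 1)) G" and free: "two_K2_free G"
  shows "k_walk k G (output_multigraph (card (verts G)) (den walk_prog (input_state k G)))"
proof (cases "card (verts G) \<ge> 2")
  case True
  then interpret tough_input "card (verts G)" k G
    using assms by unfold_locales
  show ?thesis by (rule walk_prog_correct)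
next
  case False
  have "card (verts G) > 0" using G by (simp add: simple_graph_def card_gt_0_iff)
  then have one: "card (verts G) = 1" using False by simp
  then have "output_multigraph (card (verts G)) s = \<lparr>mverts = verts G, medges = {#}\<rparr>" for s
    using V by (simp add: output_multigraph_def)
  then show ?thesis using k_walk_single_vertex[OF G one] by simp
qed

theorem theorem1:
  shows "(\<forall>k::nat. \<forall>G::'a graph.
            k \<ge> 2 \<and> simple_graph G \<and> tough (1 / (real k - 1)) G \<and> two_K2_free G \<longrightarrow>
            (\<exists>W. k_walk k G W)) \<and>
         (\<exists>(c::com) (p::nat poly). \<forall>k::nat. \<forall>G::nat graph.
            k \<ge> 2 \<and> simple_graph G \<and> verts G = {..<card (verts G)} \<and>
            tough (1 / (real k - 1)) G \<and> two_K2_free G \<longrightarrow>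
            (\<exists>t s. runs c (input_state k G) t s \<and>
                   t \<le> poly p (card (verts G)) \<and>
                   k_walk k G (output_multigraph (card (verts G)) s)))"
proof (rule conjI)
  show "\<forall>k::nat. \<forall>G::'a graph.
      k \<ge> 2 \<and> simple_graph G \<and> tough (1 / (real k - 1)) G \<and> two_K2_free G \<longrightarrow>
      (\<exists>W. k_walk k G W)"
    using k_walk_exists by blast
  obtain p :: "nat poly" where p: "\<And>s. \<exists>t. runs (com_of walk_prog) s t (den walk_prog s) \<and>
      t \<le> poly p (scalar s ''n'')"
    using walk_prog_polynomial by blast
  have "\<exists>t s. runs (com_of walk_prog) (input_state k G) t s \<and> t \<le> poly p (card (verts G)) \<and>
      k_walk k G (output_multigraph (card (verts G)) s)"
    if G: "k \<ge> 2 \<and> simple_graph G \<and> verts G = {..<card (verts G)} \<and>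
      tough (1 / (real k - 1)) G \<and> two_K2_free G" for k and G :: "nat graph"
  proof -
    have "scalar (input_state k G) ''n'' = card (verts G)" by (simp add: input_state_def)
    then obtain t where "runs (com_of walk_prog) (input_state k G) t (den walk_prog (input_state k G))"
      "t \<le> poly p (card (verts G))" using p[of "input_state k G"] by auto
    then show ?thesis using walk_prog_output[of k G] G by blast
  qed
  then show "\<exists>(c::com) (p::nat poly). \<forall>k::nat. \<forall>G::nat graph.
      k \<ge> 2 \<and> simple_graph G \<and> verts G = {..<card (verts G)} \<and>
      tough (1 / (real k - 1)) G \<and> two_K2_free G \<longrightarrow>
      (\<exists>t s. runs c (input_state k G) t s \<and> t \<le> poly p (card (verts G)) \<and>
        k_walk k G (output_multigraph (card (verts G)) s))"
    by blast
qed

end
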